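(* Let $d\ge2$, let $\Omega\subset\mathbb{R}^d$ be a bounded open set, and let $\Omega''\subset\subset\Omega'\subset\subset\Omega$ be open. Let $\alpha=\alpha_\delta$ ($\delta>0$) be the kernel described in the context, and let $f\in L^2(\Omega')$. Let $\mathbf{H}$ be either the hinged space $\mathscr{H}^2_{\alpha,H}(\Omega',\Omega'')$ or the clamped space $\mathscr{H}^2_{\alpha,C}(\Omega')$. Then there exists a unique weak solution $u\in\mathbf{H}$ of the nonlocal equation $$\mathcal{B}_\alpha[u]=f\quad\text{in }\Omega',$$ that is, a unique $u\in\mathbf{H}$ such that $\int_\Omega\mathcal{L}_\alpha[u]\,\mathcal{L}_\alpha[v]\,dx=\int_\Omega fv\,dx$ for all $v\in\mathbf{H}$.
   Context: Kernel: $\rho_\delta\in C^\infty([0,\infty);[0,\infty))$ satisfies $\int_{\mathbb{R}^d}\rho_\delta(|x|)\,dx=1$ and $\operatorname{supp}\rho_\delta\subset[0,\delta)$; $\alpha(x,y)=\alpha_\delta(x,y)=\frac{\sqrt{\rho_\delta(|x-y|)}}{|x-y|^2}(x-y)$ and $\mu(x,y)=|\alpha(x,y)|^2=\rho_\delta(|x-y|)/|x-y|^2$. Nonlocal gradient and spaces: $\mathcal{G}_\alpha[u](x,y)=(u(y)-u(x))\alpha(x,y)$ on $\Omega\times\Omega$; $\mathscr{H}^1_\alpha(\Omega)=\{u\in L^2(\Omega):\mathcal{G}_\alpha[u]\in L^2(\Omega\times\Omega)\}$; $((u,w))_1=\int_\Omega\int_\Omega\mathcal{G}_\alpha[u]\cdot\mathcal{G}_\alpha[w]\,dy\,dx$;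 $\mathscr{H}^1_{\alpha,0}(\Omega')=\{u\in\mathscr{H}^1_\alpha(\Omega):u=0\text{ a.e. in }\Omega\setminus\Omega'\}$. Nonlocal Laplacian and biharmonic (scaled by $\sigma=2d$): pointwise, $\mathcal{L}_\alpha[u](x)=2d\int_\Omega(u(y)-u(x))\mu(x,y)\,dy$ and $\mathcal{B}_\alpha[u]=\mathcal{L}_\alpha[\mathcal{L}_\alpha[u]]$. In general $\mathcal{L}_\alpha[u]$ is understood weakly: for $u\in\mathscr{H}^1_\alpha(\Omega)$, $\mathcal{L}_\alpha[u]=v\in L^2(\Omega)$ means $-d\,((u,\phi))_1=\int_\Omega v\phi\,dx$ for all $\phi\in\mathscr{H}^1_\alpha(\Omega)$. $\mathscr{H}^2_\alpha(\Omega)=\{u\in\mathscr{H}^1_\alpha(\Omega):\mathcal{L}_\alpha[u]\in L^2(\Omega)\}$. Nonlocal normal operator: for $\nu:\Omega\times\Omega\to\mathbb{R}^d$, $\mathcal{N}_\alpha[\nu](x)=\int_{\Omega\setminus\Omega'}(\nu(x,y)+\nu(y,x))\cdot\alpha(x,y)\,dy$ for $x\in\operatorname{int}(\Omega')$; for $\nu=\mathcal{G}_\alpha[u]$ this equals $2\int_{\Omega\setminus\Omega'}(u(y)-u(x))\mu(x,y)\,dy$. Hinged space: $\mathscr{H}^2_{\alpha,H}(\Omega',\Omega'')=\{u\in\mathscr{H}^1_{\alpha,0}(\Omega')\cap\mathscr{H}^2_\alpha(\Omega):\mathcal{L}_\alpha[u]=0\text{ a.e. on }\Omega'\setminus\Omega''\}$.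 Clamped space: $\mathscr{H}^2_{\alpha,C}(\Omega')=\{u\in\mathscr{H}^1_{\alpha,0}(\Omega')\cap\mathscr{H}^2_\alpha(\Omega):\mathcal{N}_\alpha[\mathcal{G}_\alpha[u]]=0\text{ a.e. on }\operatorname{int}(\Omega')\}$. Since functions in $\mathbf{H}$ vanish a.e. on $\Omega\setminus\Omega'$, $\int_\Omega fv\,dx$ means $\int_{\Omega'}fv\,dx$.
   Formalization: The formal theorem also assumes that ρ_δ(t)>0 for some t>0 such that closed balls of radius t about points of Ω' lie in Ω; otherwise ρ_δ could vanish on [0, diam Ω], making the nonlocal Laplacian zero and the claim false. *)

theory Defs
  imports "HOL-Analysis.Analysis"
begin

text \<open>
  The ambient space \<open>\<real>\<^sup>d\<close> is a type \<open>'a::euclidean_space\<close> with \<open>d = DIM('a)\<close>.  Functions on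
  \<open>\<Omega>\<close> are total functions whose values off \<open>\<Omega>\<close> are irrelevant.  Elements of \<open>L\<^sup>2\<close> are represented
  by Borel functions, without passing to the quotient by a.e. equality (every class of Lebesgue
  measurable functions has a Borel representative).
\<close>

definition L2_on :: "'b::euclidean_space set \<Rightarrow> ('b \<Rightarrow> 'c::euclidean_space) set" where
  "L2_on S = {u. set_borel_measurable lborel S u \<and>
                 set_integrable lborel S (\<lambda>x. (norm (u x))\<^sup>2)}"

definition compactly_contained :: "'a::euclidean_space set \<Rightarrow> 'a set \<Rightarrow> bool"
    (infix "\<subset>\<subset>" 50) where
  "A \<subset>\<subset> B \<longleftrightarrow> compact (closure A) \<and> closure A \<subseteq> B"

text \<open>Derivatives at the end point \<open>0\<close> of the half line are one-sided.\<close>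

definition smooth_half_line :: "(real \<Rightarrow> real) \<Rightarrow> bool" where
  "smooth_half_line r \<longleftrightarrow>
     (\<exists>D. D 0 = r \<and>
        (\<forall>n. \<forall>t\<ge>0. (D n has_real_derivative D (Suc n) t) (at t within {0..})))"

text \<open>
  \<open>nonlocal_kernel TYPE('a) \<delta> r\<close>: the profile \<open>r = \<rho>\<^sub>\<delta>\<close> is admissible on the space \<open>'a\<close>.
  Only the values of \<open>r\<close> on the half line matter.
\<close>

definition nonlocal_kernel :: "'a::euclidean_space itself \<Rightarrow> real \<Rightarrow> (real \<Rightarrow> real) \<Rightarrow> bool" where
  "nonlocal_kernel T \<delta> r \<longleftrightarrow>
     smooth_half_line r \<and> (\<forall>t\<ge>0. r t \<ge> 0) \<and>
     (LINT x|lborel. r (norm (x::'a))) = 1 \<and>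
     closure {t. t \<ge> 0 \<and> r t \<noteq> 0} \<subseteq> {0..<\<delta>}"

text \<open>
  Nondegeneracy of the kernel relative to the collar \<open>\<Omega> - \<Omega>'\<close>: some interaction length
  does not exceed the width of the collar.  This holds if \<open>r 0 > 0\<close>, and also if \<open>\<delta>\<close> is at most
  the distance from \<open>\<Omega>'\<close> to the complement of \<open>\<Omega>\<close>.  Some such condition is needed: the
  requirements in \<open>nonlocal_kernel\<close> allow \<open>r\<close> to vanish on \<open>[0, diameter \<Omega>]\<close>.  Then the nonlocal
  gradient and Laplacian are zero for every \<open>u\<close>, and \<open>B[u] = f\<close> has no solution unless \<open>f = 0\<close>,
  and many if \<open>f = 0\<close>.
\<close>

definition reaches_collar :: "(real \<Rightarrow> real) \<Rightarrow> 'a::euclidean_space set \<Rightarrow> 'a set \<Rightarrow> bool" where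
  "reaches_collar r \<Omega>' \<Omega> \<longleftrightarrow> (\<exists>t>0. r t > 0 \<and> (\<forall>x\<in>\<Omega>'. cball x t \<subseteq> \<Omega>))"

definition alpha :: "(real \<Rightarrow> real) \<Rightarrow> 'a::euclidean_space \<Rightarrow> 'a \<Rightarrow> 'a" where
  "alpha r x y = (sqrt (r (norm (x - y))) / (norm (x - y))\<^sup>2) *\<^sub>R (x - y)"

definition nl_grad ::
    "(real \<Rightarrow> real) \<Rightarrow> ('a::euclidean_space \<Rightarrow> real) \<Rightarrow> 'a \<times> 'a \<Rightarrow> 'a" where
  "nl_grad r u = (\<lambda>(x, y). (u y - u x) *\<^sub>R alpha r x y)"

definition H1 :: "(real \<Rightarrow> real) \<Rightarrow> 'a::euclidean_space set \<Rightarrow> ('a \<Rightarrow> real) set" where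
  "H1 r \<Omega> = {u \<in> L2_on \<Omega>. nl_grad r u \<in> L2_on (\<Omega> \<times> \<Omega>)}"

definition inner1 ::
    "(real \<Rightarrow> real) \<Rightarrow> 'a::euclidean_space set \<Rightarrow> ('a \<Rightarrow> real) \<Rightarrow> ('a \<Rightarrow> real) \<Rightarrow> real" where
  "inner1 r \<Omega> u w =
     (LINT x:\<Omega>|lborel. LINT y:\<Omega>|lborel. nl_grad r u (x, y) \<bullet> nl_grad r w (x, y))"

definition H1_0 ::
    "(real \<Rightarrow> real) \<Rightarrow> 'a::euclidean_space set \<Rightarrow> 'a set \<Rightarrow> ('a \<Rightarrow> real) set" where
  "H1_0 r \<Omega> \<Omega>' = {u \<in> H1 r \<Omega>. AE x in lborel. x \<in> \<Omega> - \<Omega>' \<longrightarrow> u x = 0}"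

text \<open>
  \<open>is_nl_laplacian r \<Omega> u v\<close>: the weak nonlocal Laplacian of \<open>u\<close>, scaled by \<open>2 d\<close>, is the
  \<open>L\<^sup>2\<close> function \<open>v\<close>.
\<close>

definition is_nl_laplacian ::
    "(real \<Rightarrow> real) \<Rightarrow> 'a::euclidean_space set \<Rightarrow> ('a \<Rightarrow> real) \<Rightarrow> ('a \<Rightarrow> real) \<Rightarrow> bool" where
  "is_nl_laplacian r \<Omega> u v \<longleftrightarrow>
     u \<in> H1 r \<Omega> \<and> v \<in> L2_on \<Omega> \<and>
     (\<forall>\<phi>\<in>H1 r \<Omega>. - real DIM('a) * inner1 r \<Omega> u \<phi> = (LINT x:\<Omega>|lborel. v x * \<phi> x))"

definition H2 :: "(real \<Rightarrow> real) \<Rightarrow> 'a::euclidean_space set \<Rightarrow> ('a \<Rightarrow> real) set" where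
  "H2 r \<Omega> = {u \<in> H1 r \<Omega>. \<exists>v. is_nl_laplacian r \<Omega> u v}"

text \<open>
  A representative of the weak Laplacian, meaningful for \<open>u \<in> H2 r \<Omega>\<close>.  For open \<open>\<Omega>\<close> and an
  admissible profile it is determined up to a null subset of \<open>\<Omega>\<close>.
\<close>

definition nl_laplacian ::
    "(real \<Rightarrow> real) \<Rightarrow> 'a::euclidean_space set \<Rightarrow> ('a \<Rightarrow> real) \<Rightarrow> 'a \<Rightarrow> real" where
  "nl_laplacian r \<Omega> u = (SOME v. is_nl_laplacian r \<Omega> u v)"

definition nl_normal ::
    "(real \<Rightarrow> real) \<Rightarrow> 'a::euclidean_space set \<Rightarrow> 'a set \<Rightarrow> ('a \<times> 'a \<Rightarrow> 'a) \<Rightarrow> 'a \<Rightarrow> real" where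
  "nl_normal r \<Omega> \<Omega>' \<nu> x =
     (LINT y:(\<Omega> - \<Omega>')|lborel. (\<nu> (x, y) + \<nu> (y, x)) \<bullet> alpha r x y)"

definition hinged_space ::
    "(real \<Rightarrow> real) \<Rightarrow> 'a::euclidean_space set \<Rightarrow> 'a set \<Rightarrow> 'a set \<Rightarrow> ('a \<Rightarrow> real) set" where
  "hinged_space r \<Omega> \<Omega>' \<Omega>'' =
     {u \<in> H1_0 r \<Omega> \<Omega>' \<inter> H2 r \<Omega>.
        AE x in lborel. x \<in> \<Omega>' - \<Omega>'' \<longrightarrow> nl_laplacian r \<Omega> u x = 0}"

definition clamped_space ::
    "(real \<Rightarrow> real) \<Rightarrow> 'a::euclidean_space set \<Rightarrow> 'a set \<Rightarrow> ('a \<Rightarrow> real) set" where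
  "clamped_space r \<Omega> \<Omega>' =
     {u \<in> H1_0 r \<Omega> \<Omega>' \<inter> H2 r \<Omega>.
        AE x in lborel. x \<in> interior \<Omega>' \<longrightarrow> nl_normal r \<Omega> \<Omega>' (nl_grad r u) x = 0}"

text \<open>
  Weak solutions of \<open>B[u] = f\<close> in \<open>\<Omega>'\<close>.  The load \<open>f\<close> is given on \<open>\<Omega>'\<close> only; the test functions
  vanish a.e. on \<open>\<Omega> - \<Omega>'\<close>.
\<close>

definition weak_biharmonic_solution ::
    "(real \<Rightarrow> real) \<Rightarrow> 'a::euclidean_space set \<Rightarrow> 'a set \<Rightarrow> ('a \<Rightarrow> real) set \<Rightarrow>
       ('a \<Rightarrow> real) \<Rightarrow> ('a \<Rightarrow> real) \<Rightarrow> bool" where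
  "weak_biharmonic_solution r \<Omega> \<Omega>' H f u \<longleftrightarrow>
     u \<in> H \<and>
     (\<forall>v\<in>H. (LINT x:\<Omega>|lborel. nl_laplacian r \<Omega> u x * nl_laplacian r \<Omega> v x)
             = (LINT x:\<Omega>'|lborel. f x * v x))"

end

theory Submission
  imports Defs
begin

text \<open>
  Both spaces consist of the \<open>u\<close> with an \<open>L\<^sup>2\<close> Laplacian that satisfy a.e. pointwise linear conditions
  on \<open>u\<close> and on its Laplacian; for the clamped space this is because \<open>u\<close> vanishes on the collar, so
  that \<open>N[G[u]]\<close> is a product \<open>k u\<close> on \<open>\<Omega>'\<close>.  A Poincare inequality, obtained by translating \<open>u\<close>
  repeatedly by vectors whose length is an interaction length until its support leaves \<open>\<Omega>'\<close>,
  combined with \<open>d \<parallel>G[u]\<parallel>\<^sup>2 = - \<integral> u L[u]\<close> bounds \<open>u\<close> in \<open>L\<^sup>2\<close> by \<open>L[u]\<close>.  Hence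
  the form \<open>\<integral> L[u] L[v]\<close> is a complete inner product (completeness of \<open>L\<^sup>2\<close>; the weak equation and
  the side conditions pass to the limit) for which the load is a bounded functional, and Riesz
  representation applies.
\<close>

subsection \<open>Riesz representation on spaces of functions\<close>

text \<open>For \<open>c > 0\<close> evaluate the quadratic at its minimiser \<open>- b / c\<close>.
  Besides Cauchy-Schwarz, the case \<open>a = 0\<close> gives the first-order condition at a
  minimum, since it forces \<open>b = 0\<close>.\<close>

lemma discriminant_le_of_nonneg:
  fixes a b c :: real
  assumes "\<And>t. 0 \<le> a + 2 * t * b + t\<^sup>2 * c" and "0 \<le> c"
  shows "b\<^sup>2 \<le> a * c"
proof (cases "c = 0")
  case True
  have "b = 0"
  proof (rule ccontr)
    assume "b \<noteq> 0"
    then show False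
      \<comment> \<open>At this \<open>t\<close> the affine function \<open>a + 2 * t * b\<close>
        takes the value -1.\<close>
      using assms(1)[of "- (a + 1) / (2 * b)"] True by (simp add: field_simps)
  qed
  then show ?thesis
    using True by simp
next
  case False
  then have "c > 0"
    using assms(2) by simp
  then show ?thesis
    using assms(1)[of "- b / c"] by (simp add: field_simps power2_eq_square)
qed

text \<open>Functions that agree a.e. are not identified, so the form is only semidefinite and
  limits in its seminorm are not unique. The space is a set of functions because it will be
  instantiated with subspaces that depend on parameters.\<close>

locale semi_inner_space =
  fixes H :: "('a \<Rightarrow> real) set" and B :: "('a \<Rightarrow> real) \<Rightarrow> ('a \<Rightarrow> real) \<Rightarrow> real"
  assumes zero_mem: "(\<lambda>x. 0) \<in> H"
    and comb_mem: "\<And>u v c. u \<in> H \<Longrightarrow> v \<in> H \<Longrightarrow> (\<lambda>x. u x + c * v x) \<in> H"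
    and form_comm: "\<And>u v. u \<in> H \<Longrightarrow> v \<in> H \<Longrightarrow> B u v = B v u"
    and form_comb: "\<And>u v w c. u \<in> H \<Longrightarrow> v \<in> H \<Longrightarrow> w \<in> H \<Longrightarrow>
      B (\<lambda>x. u x + c * v x) w = B u w + c * B v w"
    and form_nonneg: "\<And>u. u \<in> H \<Longrightarrow> 0 \<le> B u u"
begin

lemma diff_mem: "u \<in> H \<Longrightarrow> v \<in> H \<Longrightarrow> (\<lambda>x. u x - v x) \<in> H"
  using comb_mem[of u v "-1"] by simp

lemma form_diff:
  "u \<in> H \<Longrightarrow> v \<in> H \<Longrightarrow> w \<in> H \<Longrightarrow> B (\<lambda>x. u x - v x) w = B u w - B v w"
  using form_comb[of u v w "-1"] by simp

lemma form_comb_comb: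
  assumes "u \<in> H" "v \<in> H"
  shows "B (\<lambda>x. u x + c * v x) (\<lambda>x. u x + c * v x) = B u u + 2 * c * B u v + c\<^sup>2 * B v v"
proof -
  have "B w (\<lambda>x. u x + c * v x) = B w u + c * B w v" if "w \<in> H" for w
    using form_comb[OF assms that] form_comm[OF that comb_mem[OF assms]]
      form_comm[OF that assms(1)] form_comm[OF that assms(2)] by simp
  then show ?thesis
    using assms form_comb[OF assms comb_mem[OF assms, of c], of c] form_comm[OF assms(2,1)]
    by (simp add: power2_eq_square algebra_simps)
qed

lemma form_Cauchy_Schwarz:
  assumes "u \<in> H" "v \<in> H"
  shows "(B u v)\<^sup>2 \<le> B u u * B v v"
proof (rule discriminant_le_of_nonneg)
  show "0 \<le> B u u + 2 * t * B u v + t\<^sup>2 * B v v" for t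
    using form_nonneg[OF comb_mem[OF assms, of t]] form_comb_comb[OF assms, of t] by simp
qed (use assms form_nonneg in auto)

text \<open>By Cauchy-Schwarz \<open>(B (s n - u) v)^2\<close> is at most
  \<open>B (s n - u) (s n - u) * B v v\<close>, so the form is continuous in its first
  argument.\<close>

lemma form_tendsto:
  assumes "\<And>n. s n \<in> H" "u \<in> H" "v \<in> H"
    and lim: "(\<lambda>n. B (\<lambda>x. s n x - u x) (\<lambda>x. s n x - u x)) \<longlonglongrightarrow> 0"
  shows "(\<lambda>n. B (s n) v) \<longlonglongrightarrow> B u v"
proof -
  have "(\<lambda>n. (B (\<lambda>x. s n x - u x) v)\<^sup>2) \<longlonglongrightarrow> 0"
  proof (rule tendsto_sandwich[OF _ _ tendsto_const])
    show "(\<lambda>n. B (\<lambda>x. s n x - u x) (\<lambda>x. s n x - u x) * B v v) \<longlonglongrightarrow> 0"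
      using tendsto_mult_right[OF lim, of "B v v"] by simp
  qed (use form_Cauchy_Schwarz[OF diff_mem] assms in \<open>auto intro!: always_eventually\<close>)
  then have "(\<lambda>n. B (\<lambda>x. s n x - u x) v) \<longlonglongrightarrow> 0"
    using tendsto_real_sqrt by (fastforce simp: tendsto_rabs_zero_iff)
  then show ?thesis
    using assms by (simp add: form_diff LIM_zero_iff)
qed

text \<open>Minimising the energy \<open>B u u - 2 * F u\<close>: by the parallelogram law a minimising sequence is Cauchy.\<close>

lemma Riesz_representation:
  assumes F_comb: "\<And>u v c. u \<in> H \<Longrightarrow> v \<in> H \<Longrightarrow> F (\<lambda>x. u x + c * v x) = F u + c * F v"
    and F_bound: "\<And>u. u \<in> H \<Longrightarrow> (F u)\<^sup>2 \<le> C * B u u" and C: "0 \<le> C"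
    and complete: "\<And>s. (\<And>n. s n \<in> H) \<Longrightarrow>
      (\<And>e. e > 0 \<Longrightarrow> \<exists>N. \<forall>m\<ge>N. \<forall>n\<ge>N. B (\<lambda>x. s m x - s n x) (\<lambda>x. s m x - s n x) < e) \<Longrightarrow>
      \<exists>u\<in>H. (\<lambda>n. B (\<lambda>x. s n x - u x) (\<lambda>x. s n x - u x)) \<longlonglongrightarrow> 0"
  shows "\<exists>u\<in>H. \<forall>v\<in>H. B u v = F v"
proof -
  define J where "J u = B u u - 2 * F u" for u
  have J_comb: "J (\<lambda>x. u x + c * v x) = J u + 2 * c * (B u v - F v) + c\<^sup>2 * B v v"
    if "u \<in> H" "v \<in> H" for u v c
    using that by (simp add: J_def form_comb_comb F_comb algebra_simps)
  have J_ge: "- C \<le> J u" if "u \<in> H" for u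
  proof -
    \<comment> \<open>AM-GM in squared form: the load term \<open>2 * F u\<close> is absorbed by
      \<open>B u u + C\<close>, which bounds the energy below by \<open>- C\<close>.\<close>
    have "0 \<le> (B u u - C)\<^sup>2"
      by simp
    then have "4 * C * B u u \<le> (B u u + C)\<^sup>2"
      by (simp add: power2_eq_square algebra_simps)
    moreover have "(2 * F u)\<^sup>2 \<le> 4 * C * B u u"
      using F_bound[OF that] by (simp add: power_mult_distrib)
    ultimately have le: "(2 * F u)\<^sup>2 \<le> (B u u + C)\<^sup>2"
      by linarith
    have "2 * F u \<le> B u u + C"
      using C form_nonneg[OF that] by (intro power2_le_imp_le[OF le]) auto
    then show ?thesis
      by (simp add: J_def)
  qed
  define m where "m = (INF u\<in>H. J u)"
  have bdd: "bdd_below (J ` H)"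
    using J_ge by (intro bdd_belowI2)
  have m_le: "m \<le> J u" if "u \<in> H" for u
    unfolding m_def using bdd that by (rule cINF_lower)
  have "\<exists>u\<in>H. J u < m + inverse (real (Suc n))" for n
  proof -
    have "\<exists>y\<in>J ` H. y < m + inverse (real (Suc n))"
      using zero_mem bdd unfolding m_def by (subst cInf_less_iff[symmetric]) auto
    then show ?thesis
      by blast
  qed
  then obtain s where s: "\<And>n. s n \<in> H" and J_s: "\<And>n. J (s n) < m + inverse (real (Suc n))"
    by metis
  have Cauchy_s: "\<exists>N. \<forall>i\<ge>N. \<forall>j\<ge>N. B (\<lambda>x. s i x - s j x) (\<lambda>x. s i x - s j x) < e"
    if "e > 0" for e
  proof -
    obtain N where N: "inverse (real (Suc N)) < e / 4"
      using reals_Archimedean[of "e / 4"] \<open>e > 0\<close> by (meson divide_pos_pos zero_less_numeral)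
    have inv: "inverse (real (Suc i)) \<le> inverse (real (Suc N))" if "i \<ge> N" for i
      using that by (intro le_imp_inverse_le) auto
    have "B (\<lambda>x. s i x - s j x) (\<lambda>x. s i x - s j x) < e" if "i \<ge> N" "j \<ge> N" for i j
    proof -
      let ?D = "B (\<lambda>x. s i x - s j x) (\<lambda>x. s i x - s j x)"
      \<comment> \<open>This is the midpoint of \<open>s i\<close> and \<open>s j\<close>. Writing
        both it and \<open>s j\<close> as \<open>s i\<close> plus a multiple of the difference
        produces the same cross terms; eliminating them gives the parallelogram bound on
        \<open>?D\<close>.\<close>
      have "m \<le> J (\<lambda>x. s i x + (- 1 / 2) * (s i x - s j x))"
        using s by (intro m_le comb_mem diff_mem)
      also have "\<dots> = J (s i) - B (s i) (\<lambda>x. s i x - s j x) + F (\<lambda>x. s i x - s j x) + ?D / 4"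
        using s by (subst J_comb) (auto simp: diff_mem power2_eq_square field_simps)
      finally have 1: "m \<le> J (s i) - B (s i) (\<lambda>x. s i x - s j x) + F (\<lambda>x. s i x - s j x) + ?D / 4" .
      have "J (s j) = J (\<lambda>x. s i x + (- 1) * (s i x - s j x))"
        by simp
      also have "\<dots> = J (s i) - 2 * B (s i) (\<lambda>x. s i x - s j x) + 2 * F (\<lambda>x. s i x - s j x) + ?D"
        using s by (subst J_comb) (auto simp: diff_mem)
      finally have "?D \<le> 2 * J (s i) + 2 * J (s j) - 4 * m"
        using 1 by linarith
      also have "\<dots> < 2 * inverse (real (Suc i)) + 2 * inverse (real (Suc j))"
        using J_s[of i] J_s[of j] by linarith
      also have "\<dots> \<le> 4 * inverse (real (Suc N))"
        using inv[OF that(1)] inv[OF that(2)] by linarith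
      finally show ?thesis
        using N by linarith
    qed
    then show ?thesis
      by blast
  qed
  obtain u where u: "u \<in> H" and lim: "(\<lambda>n. B (\<lambda>x. s n x - u x) (\<lambda>x. s n x - u x)) \<longlonglongrightarrow> 0"
    using complete[OF s Cauchy_s] by blast
  have "B u v = F v" if v: "v \<in> H" for v
  proof -
    \<comment> \<open>First variation, taken along the sequence: perturbing \<open>s n\<close> by
      \<open>t * v\<close> cannot lower the energy by more than \<open>inverse (Suc n)\<close>, and
      this passes to the limit. The leading 0 is the constant coefficient \<open>a\<close> of the
      discriminant lemma.\<close>
    have "0 \<le> 0 + 2 * t * (B u v - F v) + t\<^sup>2 * B v v" for t
    proof (rule LIMSEQ_le)
      show "(\<lambda>n. 0 + 2 * t * (B (s n) v - F v) + t\<^sup>2 * B v v)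
        \<longlonglongrightarrow> 0 + 2 * t * (B u v - F v) + t\<^sup>2 * B v v"
        by (intro tendsto_intros form_tendsto s u v lim)
      show "(\<lambda>n. - inverse (real (Suc n))) \<longlonglongrightarrow> 0"
        using tendsto_minus[OF LIMSEQ_inverse_real_of_nat] by simp
      have "- inverse (real (Suc n)) \<le> 0 + 2 * t * (B (s n) v - F v) + t\<^sup>2 * B v v" for n
        using m_le[OF comb_mem[OF s v, of n t]] J_s[of n] J_comb[OF s v, of n t] by linarith
      then show "\<exists>N. \<forall>n\<ge>N. - inverse (real (Suc n)) \<le> 0 + 2 * t * (B (s n) v - F v) + t\<^sup>2 * B v v"
        by blast
    qed
    from discriminant_le_of_nonneg[OF this form_nonneg[OF v]] show ?thesis
      by simp
  qed
  then show ?thesis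
    using u by blast
qed

end

subsection \<open>Square integrable functions\<close>

definition square_integrable :: "'b measure \<Rightarrow> ('b \<Rightarrow> real) \<Rightarrow> bool" where
  "square_integrable M u \<longleftrightarrow> u \<in> borel_measurable M \<and> integrable M (\<lambda>x. (u x)\<^sup>2)"

lemma square_integrable_measurable [measurable_dest]:
  "square_integrable M u \<Longrightarrow> u \<in> borel_measurable M"
  by (simp add: square_integrable_def)

lemma square_integrable_mult:
  assumes [measurable]: "square_integrable M u" "square_integrable M v"
  shows "integrable M (\<lambda>x. u x * v x)"
proof (rule Bochner_Integration.integrable_bound[where f = "\<lambda>x. (u x)\<^sup>2 + (v x)\<^sup>2"])
  have "\<bar>a * b\<bar> \<le> a\<^sup>2 + b\<^sup>2" for a b :: real
  proof -
    have "2 * (\<bar>a\<bar> * \<bar>b\<bar>) \<le> a\<^sup>2 + b\<^sup>2"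
      using sum_squares_bound[of "\<bar>a\<bar>" "\<bar>b\<bar>"] by simp
    moreover have "0 \<le> \<bar>a\<bar> * \<bar>b\<bar>"
      by simp
    ultimately show ?thesis
      unfolding abs_mult by linarith
  qed
  then show "AE x in M. norm (u x * v x) \<le> norm ((u x)\<^sup>2 + (v x)\<^sup>2)"
    by simp
qed (use assms in \<open>auto simp: square_integrable_def\<close>)

lemma square_integrable_comb:
  assumes "square_integrable M u" "square_integrable M v"
  shows "square_integrable M (\<lambda>x. u x + c * v x)"
proof -
  have "integrable M (\<lambda>x. (u x)\<^sup>2 + 2 * c * (u x * v x) + c\<^sup>2 * (v x)\<^sup>2)"
    using assms square_integrable_mult[OF assms]
    by (auto simp: square_integrable_def)
  then show ?thesis
    using assms by (auto simp: square_integrable_def power2_eq_square algebra_simps)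
qed

lemma square_integrable_diff:
  assumes "square_integrable M u" "square_integrable M v"
  shows "square_integrable M (\<lambda>x. u x - v x)"
  using square_integrable_comb[OF assms, of "-1"] by simp

text \<open>The measure stays free because the form lemmas are applied both to functions on the
  domain and to gradients on its square.\<close>

interpretation L2: semi_inner_space "Collect (square_integrable M)" "\<lambda>u v. LINT x|M. u x * v x"
  for M :: "'b measure"
proof
  fix u v w :: "'b \<Rightarrow> real" and c :: real
  assume "u \<in> Collect (square_integrable M)" "v \<in> Collect (square_integrable M)"
    "w \<in> Collect (square_integrable M)"
  then show "(LINT x|M. (u x + c * v x) * w x) = (LINT x|M. u x * w x) + c * (LINT x|M. v x * w x)"
    using square_integrable_mult[of M u w] square_integrable_mult[of M v w]
    by (simp add: distrib_right mult.assoc)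
qed (auto simp: square_integrable_comb mult.commute, auto simp: square_integrable_def)

text \<open>Fatou's lemma for the squares. The bound is required only eventually, which is how tails
  of Cauchy sequences supply it.\<close>

lemma square_integrable_Fatou:
  assumes s: "\<And>n. square_integrable M (s n)" and [measurable]: "u \<in> borel_measurable M"
    and lim: "AE x in M. (\<lambda>n. s n x) \<longlonglongrightarrow> u x"
    and bound: "eventually (\<lambda>n. (LINT x|M. (s n x)\<^sup>2) \<le> C) sequentially"
  shows "square_integrable M u" and "(LINT x|M. (u x)\<^sup>2) \<le> C"
proof -
  have [measurable]: "s n \<in> borel_measurable M" for n
    using s[of n] by measurable
  obtain n where "(LINT x|M. (s n x)\<^sup>2) \<le> C"
    using bound by (auto simp: eventually_sequentially)
  then have C: "0 \<le> C"
    by (rule order.trans[rotated]) simp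
  have "(\<integral>\<^sup>+x. ennreal ((u x)\<^sup>2) \<partial>M) = (\<integral>\<^sup>+x. liminf (\<lambda>n. ennreal ((s n x)\<^sup>2)) \<partial>M)"
  proof (rule nn_integral_cong_AE, use lim in eventually_elim)
    case (elim x)
    have "(\<lambda>n. ennreal ((s n x)\<^sup>2)) \<longlonglongrightarrow> ennreal ((u x)\<^sup>2)"
      using elim by (intro tendsto_ennrealI tendsto_intros)
    then show ?case
      using lim_imp_Liminf by (metis sequentially_bot)
  qed
  also have "\<dots> \<le> liminf (\<lambda>n. \<integral>\<^sup>+x. ennreal ((s n x)\<^sup>2) \<partial>M)"
    by (rule nn_integral_liminf) auto
  also have "\<dots> \<le> ennreal C"
  proof (rule Liminf_le)
    show "\<forall>\<^sub>F n in sequentially. (\<integral>\<^sup>+x. ennreal ((s n x)\<^sup>2) \<partial>M) \<le> ennreal C"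
      using bound by eventually_elim
        (use s in \<open>auto simp: nn_integral_eq_integral square_integrable_def ennreal_leI\<close>)
  qed simp
  finally have le: "(\<integral>\<^sup>+x. ennreal ((u x)\<^sup>2) \<partial>M) \<le> ennreal C" .
  then show "square_integrable M u"
    using le_less_trans[OF le ennreal_less_top]
    by (auto simp: square_integrable_def intro!: integrableI_nonneg)
  show "(LINT x|M. (u x)\<^sup>2) \<le> C"
    using le C by (intro integral_real_bounded) auto
qed

text \<open>Fix \<open>n\<close> and apply Fatou to \<open>s n - s (k m)\<close> as \<open>m\<close>
  grows: the Cauchy bound carries over to \<open>s n - u\<close>. The a.e. limit is given in
  advance, so the lemma can also identify the limit of the gradients \<open>D (s n)\<close> as
  \<open>D u\<close>.\<close>

lemma square_integrable_limit:
  assumes s: "\<And>n. square_integrable M (s n)" and [measurable]: "u \<in> borel_measurable M"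
    and Cauchy: "\<And>e. e > 0 \<Longrightarrow> \<exists>N. \<forall>i\<ge>N. \<forall>j\<ge>N. (LINT x|M. (s i x - s j x)\<^sup>2) < e"
    and k: "strict_mono (k :: nat \<Rightarrow> nat)"
    and lim: "AE x in M. (\<lambda>n. s (k n) x) \<longlonglongrightarrow> u x"
  shows "square_integrable M u" and "(\<lambda>n. LINT x|M. (s n x - u x)\<^sup>2) \<longlonglongrightarrow> 0"
proof -
  have [measurable]: "s n \<in> borel_measurable M" for n
    using s[of n] by measurable
  have tail: "\<exists>N. \<forall>n\<ge>N. square_integrable M (\<lambda>x. s n x - u x) \<and> (LINT x|M. (s n x - u x)\<^sup>2) \<le> e"
    if "e > 0" for e
  proof -
    obtain N where N: "(LINT x|M. (s i x - s j x)\<^sup>2) < e" if "i \<ge> N" "j \<ge> N" for i j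
      using Cauchy[OF \<open>e > 0\<close>] by blast
    have "square_integrable M (\<lambda>x. s n x - u x) \<and> (LINT x|M. (s n x - u x)\<^sup>2) \<le> e"
      if "n \<ge> N" for n
    proof -
      \<comment> \<open>Since \<open>k m >= m\<close>, the subsequence also has its indices beyond
        \<open>N\<close>.\<close>
      have ev: "eventually (\<lambda>m. (LINT x|M. (s n x - s (k m) x)\<^sup>2) \<le> e) sequentially"
        using eventually_ge_at_top[of N]
        by eventually_elim (use N that seq_suble[OF k] in \<open>meson less_imp_le order.trans\<close>)
      have AE: "AE x in M. (\<lambda>m. s n x - s (k m) x) \<longlonglongrightarrow> s n x - u x"
        using lim by eventually_elim (intro tendsto_intros)
      show ?thesis
        using square_integrable_Fatou[OF square_integrable_diff[OF s s] _ AE ev] by simp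
    qed
    then show ?thesis
      by blast
  qed
  obtain n where "square_integrable M (\<lambda>x. s n x - u x)"
    using tail[of 1] by auto
  from square_integrable_diff[OF s[of n] this] show "square_integrable M u"
    by simp
  show "(\<lambda>n. LINT x|M. (s n x - u x)\<^sup>2) \<longlonglongrightarrow> 0"
  proof (rule LIMSEQ_I)
    fix e :: real assume "e > 0"
    then obtain N where "\<forall>n\<ge>N. (LINT x|M. (s n x - u x)\<^sup>2) \<le> e / 2"
      using tail[of "e / 2"] by auto
    then show "\<exists>N. \<forall>n\<ge>N. norm ((LINT x|M. (s n x - u x)\<^sup>2) - 0) < e"
      using \<open>e > 0\<close> by (intro exI[of _ N]) fastforce
  qed
qed

text \<open>On a finite measure space Cauchy-Schwarz against the constant 1 makes the sequence
  Cauchy in L1, which yields an a.e. convergent subsequence. That subsequence is part of the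
  conclusion because pointwise side conditions are later passed to the limit along it.\<close>

lemma square_integrable_complete:
  assumes "finite_measure M" and s: "\<And>n. square_integrable M (s n)"
    and Cauchy: "\<And>e. e > 0 \<Longrightarrow> \<exists>N. \<forall>i\<ge>N. \<forall>j\<ge>N. (LINT x|M. (s i x - s j x)\<^sup>2) < e"
  obtains u k where "square_integrable M u" "strict_mono k"
    "AE x in M. (\<lambda>n. s (k n) x) \<longlonglongrightarrow> u x" "(\<lambda>n. LINT x|M. (s n x - u x)\<^sup>2) \<longlonglongrightarrow> 0"
proof -
  interpret finite_measure M by fact
  have [measurable]: "s n \<in> borel_measurable M" for n
    using s[of n] by measurable
  have L1: "\<exists>N. \<forall>i\<ge>N. \<forall>j\<ge>N. (LINT x|M. norm (s i x - s j x)) < e" if "e > 0" for e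
  proof -
    \<comment> \<open>The summand 1 keeps the divisor positive when the whole space is null.\<close>
    define c where "c = measure M (space M) + 1"
    have c: "c > 0"
      unfolding c_def by (smt (verit) measure_nonneg)
    have "e\<^sup>2 / c > 0"
      using \<open>e > 0\<close> c by simp
    from Cauchy[OF this] obtain N where
      N: "(LINT x|M. (s i x - s j x)\<^sup>2) < e\<^sup>2 / c" if "i \<ge> N" "j \<ge> N" for i j
      by blast
    have "(LINT x|M. norm (s i x - s j x)) < e" if ij: "i \<ge> N" "j \<ge> N" for i j
    proof (rule power2_less_imp_less[OF _ less_imp_le[OF \<open>e > 0\<close>]])
      let ?d = "\<lambda>x. norm (s i x - s j x)"
      have "square_integrable M ?d"
        using square_integrable_diff[OF s s, of i j] by (simp add: square_integrable_def)
      moreover have "square_integrable M (\<lambda>x. 1)"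
        by (simp add: square_integrable_def)
      ultimately have "(LINT x|M. ?d x * 1)\<^sup>2 \<le> (LINT x|M. ?d x * ?d x) * (LINT x|M. 1 * 1)"
        using L2.form_Cauchy_Schwarz[of ?d M "\<lambda>x. 1"] by blast
      also have "\<dots> = (LINT x|M. (s i x - s j x)\<^sup>2) * measure M (space M)"
        by (simp add: power2_eq_square)
      also have "\<dots> \<le> (LINT x|M. (s i x - s j x)\<^sup>2) * c"
        by (intro mult_left_mono) (auto simp: c_def)
      also have "\<dots> < e\<^sup>2"
        using N[OF ij] c by (simp add: field_simps)
      finally show "(LINT x|M. ?d x)\<^sup>2 < e\<^sup>2"
        by simp
    qed
    then show ?thesis
      by blast
  qed
  have int: "integrable M (s n)" for n
    by (rule square_integrable_imp_integrable) (use s[of n] in \<open>simp_all add: square_integrable_def\<close>)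
  obtain k where k: "strict_mono k" and AE: "AE x in M. Cauchy (\<lambda>n. s (k n) x)"
    using cauchy_L1_AE_cauchy_subseq[OF int L1] .
  define u where "u x = lim (\<lambda>n. s (k n) x)" for x
  have u: "u \<in> borel_measurable M"
    unfolding u_def by measurable
  have lim: "AE x in M. (\<lambda>n. s (k n) x) \<longlonglongrightarrow> u x"
    using AE unfolding u_def by eventually_elim (simp add: Cauchy_convergent_iff convergent_LIMSEQ_iff)
  from square_integrable_limit[OF s u Cauchy k lim] show thesis
    using that k lim by blast
qed

subsection \<open>Translations\<close>

lemma nn_integral_lborel_translation:
  fixes c :: "'a::euclidean_space"
  assumes [measurable]: "f \<in> borel_measurable borel"
  shows "(\<integral>\<^sup>+x. f (c + x) \<partial>lborel) = (\<integral>\<^sup>+x. f x \<partial>lborel)"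
  by (subst (2) lborel_distr_plus[of c, symmetric]) (simp add: nn_integral_distr)

text \<open>Since \<open>u (x + N h)\<close> vanishes for \<open>x \<in> S\<close>, \<open>u x\<close> is the sum of the \<open>N\<close> increments along the
  way, which all have the same \<open>L\<^sup>2\<close> norm.\<close>

lemma nn_integral_square_le_increment:
  fixes u :: "'a::euclidean_space \<Rightarrow> real"
  assumes [measurable]: "u \<in> borel_measurable borel"
    and supp: "\<And>x. x \<notin> S \<Longrightarrow> u x = 0" and S: "\<And>x. x \<in> S \<Longrightarrow> norm x \<le> R"
    and N: "2 * R < real N * norm h"
  shows "(\<integral>\<^sup>+x. ennreal ((u x)\<^sup>2) \<partial>lborel) \<le>
    ennreal ((real N)\<^sup>2) * (\<integral>\<^sup>+x. ennreal ((u (x + h) - u x)\<^sup>2) \<partial>lborel)"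
proof -
  define g where "g y = ennreal ((u (y + h) - u y)\<^sup>2)" for y
  have [measurable]: "g \<in> borel_measurable borel"
    unfolding g_def by measurable
  have "ennreal ((u x)\<^sup>2) \<le> ennreal (real N) * (\<Sum>k<N. g (real k *\<^sub>R h + x))" for x
  proof -
    have "(u x)\<^sup>2 \<le> (\<Sum>k<N. u (x + real (Suc k) *\<^sub>R h) - u (x + real k *\<^sub>R h))\<^sup>2"
    proof (cases "x \<in> S")
      case True
      have "x + real N *\<^sub>R h \<notin> S"
      proof
        assume "x + real N *\<^sub>R h \<in> S"
        then have "norm (x + real N *\<^sub>R h) \<le> R" "norm x \<le> R"
          using S True by auto
        then show False
          using N norm_triangle_ineq4[of "x + real N *\<^sub>R h" x] by simp
      qed
      then show ?thesis
        by (subst sum_lessThan_telescope) (simp add: supp)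
    qed (simp add: supp)
    \<comment> \<open>Cauchy-Schwarz for \<open>N\<close> summands costs one factor
      \<open>N\<close>; the \<open>N\<close> equal integrals of the translates contribute the
      other.\<close>
    also have "\<dots> \<le> (\<Sum>k<N. (u (x + real (Suc k) *\<^sub>R h) - u (x + real k *\<^sub>R h))\<^sup>2) * real N"
      using sum_squared_le_sum_of_squares[of _ "{..<N}"] by simp
    finally have "ennreal ((u x)\<^sup>2) \<le>
        ennreal ((\<Sum>k<N. (u (x + real (Suc k) *\<^sub>R h) - u (x + real k *\<^sub>R h))\<^sup>2) * real N)"
      by (rule ennreal_leI)
    then show ?thesis
      by (simp add: g_def ennreal_mult sum_nonneg mult.commute algebra_simps)
  qed
  then have "(\<integral>\<^sup>+x. ennreal ((u x)\<^sup>2) \<partial>lborel) \<le>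
      (\<integral>\<^sup>+x. ennreal (real N) * (\<Sum>k<N. g (real k *\<^sub>R h + x)) \<partial>lborel)"
    by (intro nn_integral_mono)
  also have "\<dots> = ennreal (real N) * (\<Sum>k<N. \<integral>\<^sup>+x. g (real k *\<^sub>R h + x) \<partial>lborel)"
    by (simp add: nn_integral_cmult nn_integral_sum)
  also have "\<dots> = ennreal ((real N)\<^sup>2) * (\<integral>\<^sup>+x. g x \<partial>lborel)"
    by (simp add: nn_integral_lborel_translation power2_eq_square ennreal_mult mult.assoc
        flip: ennreal_of_nat_eq_real_of_nat)
  finally show ?thesis
    by (simp add: g_def)
qed

subsection \<open>The weak nonlocal Laplacian\<close>

text \<open>An exceptional null set \<open>Z\<close> gives the null cylinders
  \<open>Z \<times> UNIV\<close> and \<open>UNIV \<times> Z\<close>. This carries a.e. statements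
  about functions over to their gradients.\<close>

lemma AE_restrict_square:
  fixes \<Omega> :: "'a::euclidean_space set"
  assumes [measurable]: "\<Omega> \<in> sets borel" and "AE x in restrict_space lborel \<Omega>. P x"
  shows "AE p in restrict_space lborel (\<Omega> \<times> \<Omega>). P (fst p) \<and> P (snd p)"
proof -
  have "AE x in lborel. x \<in> \<Omega> \<longrightarrow> P x"
    using assms(2) by (subst (asm) AE_restrict_space_iff) auto
  then obtain Z where Z: "{x. \<not> (x \<in> \<Omega> \<longrightarrow> P x)} \<subseteq> Z" "Z \<in> null_sets lborel"
    by (auto simp: eventually_ae_filter)
  have "(Z \<times> UNIV) \<union> (UNIV \<times> Z) \<in> null_sets (lborel \<Otimes>\<^sub>M lborel)"
    using Z by (intro null_sets.Un lborel.times_in_null_sets1 lborel.times_in_null_sets2) auto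
  then have "(Z \<times> UNIV) \<union> (UNIV \<times> Z) \<in> null_sets lborel"
    by (simp add: lborel_prod)
  then have "AE p in lborel. p \<in> \<Omega> \<times> \<Omega> \<longrightarrow> P (fst p) \<and> P (snd p)"
    by (rule AE_I') (use Z(1) in auto)
  moreover have "\<Omega> \<times> \<Omega> \<in> sets lborel"
    by (simp add: borel_Times)
  ultimately show ?thesis
    by (subst AE_restrict_space_iff) auto
qed

locale nonlocal_domain =
  fixes r :: "real \<Rightarrow> real" and \<Omega> :: "'a::euclidean_space set"
  assumes open_domain: "open \<Omega>" and bounded_domain: "bounded \<Omega>"
    and profile_continuous: "continuous_on {0..} r"
    and profile_nonneg: "\<And>t. 0 \<le> t \<Longrightarrow> 0 \<le> r t"
begin

abbreviation M :: "'a measure" where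
  "M \<equiv> restrict_space lborel \<Omega>"

abbreviation MM :: "('a \<times> 'a) measure" where
  "MM \<equiv> restrict_space lborel (\<Omega> \<times> \<Omega>)"

text \<open>The scalar form of the nonlocal gradient: \<open>D u p * D v p = nl_grad r u p \<bullet> nl_grad r v p\<close>.\<close>

definition D :: "('a \<Rightarrow> real) \<Rightarrow> 'a \<times> 'a \<Rightarrow> real" where
  "D u p = (u (snd p) - u (fst p)) * norm (alpha r (fst p) (snd p))"

lemma domain_sets [measurable]: "\<Omega> \<in> sets borel"
  using open_domain by simp

lemma domain_square_sets [measurable]: "\<Omega> \<times> \<Omega> \<in> sets borel"
  by (simp add: borel_Times)

lemma finite_measure_M: "finite_measure M"
  using emeasure_bounded_finite[OF bounded_domain]
  by (intro finite_measureI) (simp add: space_restrict_space emeasure_restrict_space)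

lemma finite_measure_MM: "finite_measure MM"
  using emeasure_bounded_finite[OF bounded_Times[OF bounded_domain bounded_domain]]
  by (intro finite_measureI) (simp add: space_restrict_space emeasure_restrict_space)

lemma profile_norm_measurable [measurable]: "(\<lambda>x::'b::real_normed_vector. r (norm x)) \<in> borel_measurable borel"
  by (intro borel_measurable_continuous_onI continuous_on_compose2[OF profile_continuous])
    (auto intro!: continuous_intros)

lemma alpha_measurable [measurable]:
  "(\<lambda>p. alpha r (fst p) (snd p)) \<in> borel_measurable (borel :: ('a \<times> 'a) measure)"
  unfolding alpha_def borel_prod[symmetric] by measurable

text \<open>This is the kernel \<mu>. On the diagonal both sides are 0, by the convention for
  division by zero.\<close>

lemma norm_alpha_squared: "(norm (alpha r x y))\<^sup>2 = r (norm (x - y)) / (norm (x - y))\<^sup>2"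
  using profile_nonneg[of "norm (x - y)"]
  by (simp add: alpha_def power_mult_distrib power_divide power2_eq_square)

lemma fst_snd_measurable [measurable]: "fst \<in> measurable MM M" "snd \<in> measurable MM M"
  by (auto intro!: measurable_restrict_space3 simp: borel_prod[symmetric])

lemma D_measurable [measurable]:
  assumes [measurable]: "u \<in> borel_measurable M"
  shows "D u \<in> borel_measurable MM"
proof -
  have [measurable]: "(\<lambda>p. alpha r (fst p) (snd p)) \<in> borel_measurable MM"
    by (intro measurable_restrict_space1) simp
  show ?thesis
    unfolding D_def by measurable
qed

lemma D_comb: "D (\<lambda>x. u x + c * v x) = (\<lambda>p. D u p + c * D v p)"
  by (simp add: D_def fun_eq_iff algebra_simps)

lemma D_diff: "D (\<lambda>x. u x - v x) = (\<lambda>p. D u p - D v p)"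
  by (simp add: D_def fun_eq_iff algebra_simps)

lemma set_integral_domain: "(LINT x:\<Omega>|lborel. (g x :: real)) = (LINT x|M. g x)"
  by (simp add: set_lebesgue_integral_def integral_restrict_space)

lemma L2_on_iff: "u \<in> L2_on \<Omega> \<longleftrightarrow> square_integrable M u"
  by (simp add: L2_on_def square_integrable_def set_borel_measurable_def set_integrable_def
      borel_measurable_restrict_space_iff integrable_restrict_space)

text \<open>The norm of the vector gradient equals the absolute value of \<open>D u\<close>, so the
  L2 theory of real functions covers the energy.\<close>

lemma H1_iff: "u \<in> H1 r \<Omega> \<longleftrightarrow> square_integrable M u \<and> square_integrable MM (D u)"
proof -
  have "nl_grad r u \<in> borel_measurable MM" if [measurable]: "u \<in> borel_measurable M"
  proof -
    have [measurable]: "(\<lambda>p. alpha r (fst p) (snd p)) \<in> borel_measurable MM"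
      by (intro measurable_restrict_space1) simp
    show ?thesis
      unfolding nl_grad_def case_prod_beta by measurable
  qed
  moreover have "(norm (nl_grad r u p))\<^sup>2 = (D u p)\<^sup>2" for p
    by (simp add: nl_grad_def D_def case_prod_beta power_mult_distrib)
  moreover have "nl_grad r u \<in> L2_on (\<Omega> \<times> \<Omega>) \<longleftrightarrow>
      nl_grad r u \<in> borel_measurable MM \<and> integrable MM (\<lambda>p. (norm (nl_grad r u p))\<^sup>2)"
    by (simp add: L2_on_def set_borel_measurable_def set_integrable_def
        borel_measurable_restrict_space_iff integrable_restrict_space)
  ultimately show ?thesis
    by (auto simp: H1_def L2_on_iff square_integrable_def)
qed

text \<open>Fubini; the product of two square integrable gradients is integrable on the square of
  the domain.\<close>

lemma inner1_eq:
  assumes "u \<in> H1 r \<Omega>" "w \<in> H1 r \<Omega>"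
  shows "inner1 r \<Omega> u w = (LINT p|MM. D u p * D w p)"
proof -
  let ?g = "\<lambda>p. indicator (\<Omega> \<times> \<Omega>) p *\<^sub>R (D u p * D w p)"
  have "integrable MM (\<lambda>p. D u p * D w p)"
    using assms by (intro square_integrable_mult) (auto simp: H1_iff)
  then have int: "integrable (lborel \<Otimes>\<^sub>M lborel) ?g"
    by (simp add: integrable_restrict_space lborel_prod)
  have "nl_grad r u (x, y) \<bullet> nl_grad r w (x, y) = D u (x, y) * D w (x, y)" for x y
    by (simp add: nl_grad_def D_def power2_norm_eq_inner[symmetric] power2_eq_square)
  then have "inner1 r \<Omega> u w = (LINT x|lborel. LINT y|lborel. ?g (x, y))"
    unfolding inner1_def set_lebesgue_integral_def
    by (intro Bochner_Integration.integral_cong) (auto simp: indicator_def)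
  also have "\<dots> = integral\<^sup>L (lborel \<Otimes>\<^sub>M lborel) ?g"
    using int by (rule lborel_pair.integral_fst')
  also have "\<dots> = (LINT p|MM. D u p * D w p)"
    by (simp add: integral_restrict_space lborel_prod)
  finally show ?thesis .
qed

lemma H1_comb:
  "u \<in> H1 r \<Omega> \<Longrightarrow> v \<in> H1 r \<Omega> \<Longrightarrow> (\<lambda>x. u x + c * v x) \<in> H1 r \<Omega>"
  by (simp add: H1_iff D_comb square_integrable_comb)

lemma laplacian_H1: "is_nl_laplacian r \<Omega> u v \<Longrightarrow> u \<in> H1 r \<Omega>"
  by (simp add: is_nl_laplacian_def)

lemma laplacian_square_integrable:
  "is_nl_laplacian r \<Omega> u v \<Longrightarrow> square_integrable M u"
  "is_nl_laplacian r \<Omega> u v \<Longrightarrow> square_integrable MM (D u)"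
  "is_nl_laplacian r \<Omega> u v \<Longrightarrow> square_integrable M v"
  by (auto simp: is_nl_laplacian_def H1_iff L2_on_iff)

lemma laplacian_weak:
  assumes "is_nl_laplacian r \<Omega> u v" "\<phi> \<in> H1 r \<Omega>"
  shows "(LINT x|M. v x * \<phi> x) = - real DIM('a) * (LINT p|MM. D u p * D \<phi> p)"
  using assms by (auto simp: is_nl_laplacian_def inner1_eq set_integral_domain)

lemma laplacianI:
  assumes "u \<in> H1 r \<Omega>" "square_integrable M v"
    and "\<And>\<phi>. \<phi> \<in> H1 r \<Omega> \<Longrightarrow> (LINT x|M. v x * \<phi> x) = - real DIM('a) * (LINT p|MM. D u p * D \<phi> p)"
  shows "is_nl_laplacian r \<Omega> u v"
  using assms by (simp add: is_nl_laplacian_def inner1_eq set_integral_domain L2_on_iff)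

lemma laplacian_comb:
  assumes u: "is_nl_laplacian r \<Omega> u u'" and v: "is_nl_laplacian r \<Omega> v v'"
  shows "is_nl_laplacian r \<Omega> (\<lambda>x. u x + c * v x) (\<lambda>x. u' x + c * v' x)"
proof (rule laplacianI)
  fix \<phi> assume \<phi>: "\<phi> \<in> H1 r \<Omega>"
  then have "square_integrable M \<phi>" "square_integrable MM (D \<phi>)"
    by (auto simp: H1_iff)
  then show "(LINT x|M. (u' x + c * v' x) * \<phi> x)
      = - real DIM('a) * (LINT p|MM. D (\<lambda>x. u x + c * v x) p * D \<phi> p)"
    using u v laplacian_weak[OF u \<phi>] laplacian_weak[OF v \<phi>]
    using L2.form_comb[of u' M v' \<phi> c] L2.form_comb[of "D u" MM "D v" "D \<phi>" c]
    by (simp add: D_comb laplacian_square_integrable distrib_left)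
qed (intro H1_comb square_integrable_comb laplacian_H1[OF u] laplacian_H1[OF v]
    laplacian_square_integrable(3)[OF u] laplacian_square_integrable(3)[OF v])+

lemma laplacian_diff:
  assumes "is_nl_laplacian r \<Omega> u u'" "is_nl_laplacian r \<Omega> v v'"
  shows "is_nl_laplacian r \<Omega> (\<lambda>x. u x - v x) (\<lambda>x. u' x - v' x)"
  using laplacian_comb[OF assms, of "-1"] by simp

lemma laplacian_zero: "is_nl_laplacian r \<Omega> (\<lambda>x. 0) (\<lambda>x. 0)"
  by (rule laplacianI) (auto simp: H1_iff D_def square_integrable_def)

text \<open>Test the weak equation with \<open>u\<close> itself.\<close>

lemma laplacian_energy:
  assumes "is_nl_laplacian r \<Omega> u v"
  shows "real DIM('a) * (LINT p|MM. (D u p)\<^sup>2) = - (LINT x|M. u x * v x)"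
  using laplacian_weak[OF assms laplacian_H1[OF assms]]
  by (simp add: power2_eq_square mult.commute)

text \<open>Applied to differences, this makes gradients Cauchy as soon as the functions and their
  Laplacians are. It uses only that the dimension is at least 1 and that \<open>- u v\<close> is at
  most \<open>u^2 + v^2\<close>.\<close>

lemma laplacian_energy_le:
  assumes uv: "is_nl_laplacian r \<Omega> u v"
  shows "(LINT p|MM. (D u p)\<^sup>2) \<le> (LINT x|M. (u x)\<^sup>2) + (LINT x|M. (v x)\<^sup>2)"
proof -
  have sq: "square_integrable M u" "square_integrable M v"
    using uv laplacian_square_integrable by blast+
  have "1 \<le> real DIM('a)"
    by (simp add: Suc_leI)
  then have "(LINT p|MM. (D u p)\<^sup>2) \<le> real DIM('a) * (LINT p|MM. (D u p)\<^sup>2)"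
    using mult_right_mono[of 1 "real DIM('a)" "LINT p|MM. (D u p)\<^sup>2"] by simp
  also have "\<dots> = (LINT x|M. - (u x * v x))"
    using laplacian_energy[OF uv] by simp
  also have "\<dots> \<le> (LINT x|M. (u x)\<^sup>2 + (v x)\<^sup>2)"
  proof (rule integral_mono)
    show "- (u x * v x) \<le> (u x)\<^sup>2 + (v x)\<^sup>2" for x
      using zero_le_power2[of "u x + v x"] zero_le_power2[of "u x"] zero_le_power2[of "v x"]
      unfolding power2_sum by linarith
  qed (use sq square_integrable_mult[OF sq] in \<open>auto simp: square_integrable_def\<close>)
  also have "\<dots> = (LINT x|M. (u x)\<^sup>2) + (LINT x|M. (v x)\<^sup>2)"
    using sq by (simp add: square_integrable_def)
  finally show ?thesis .
qed

text \<open>The weak Laplacian is a closed operator. Its graph is Cauchy in both components, hence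
  so are the gradients; a.e. convergence along \<open>k\<close> shows that their limit is
  \<open>D u\<close>, and the weak equation for each fixed test function passes to the
  limit.\<close>

lemma laplacian_complete:
  assumes lap: "\<And>n. is_nl_laplacian r \<Omega> (s n) (t n)"
    and Cauchy_s: "\<And>e. e > 0 \<Longrightarrow> \<exists>N. \<forall>i\<ge>N. \<forall>j\<ge>N. (LINT x|M. (s i x - s j x)\<^sup>2) < e"
    and Cauchy_t: "\<And>e. e > 0 \<Longrightarrow> \<exists>N. \<forall>i\<ge>N. \<forall>j\<ge>N. (LINT x|M. (t i x - t j x)\<^sup>2) < e"
  obtains u v k l where "is_nl_laplacian r \<Omega> u v"
    "AE x in M. (\<lambda>n. s (k n) x) \<longlonglongrightarrow> u x" "AE x in M. (\<lambda>n. t (l n) x) \<longlonglongrightarrow> v x"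
    "(\<lambda>n. LINT x|M. (t n x - v x)\<^sup>2) \<longlonglongrightarrow> 0"
proof -
  note sq = laplacian_square_integrable[OF lap]
  obtain u k where u: "square_integrable M u" and k: "strict_mono k"
    and AE_s: "AE x in M. (\<lambda>n. s (k n) x) \<longlonglongrightarrow> u x"
    and lim_s: "(\<lambda>n. LINT x|M. (s n x - u x)\<^sup>2) \<longlonglongrightarrow> 0"
    using square_integrable_complete[OF finite_measure_M sq(1) Cauchy_s] .
  obtain v l where v: "square_integrable M v" and "strict_mono l"
    and AE_t: "AE x in M. (\<lambda>n. t (l n) x) \<longlonglongrightarrow> v x"
    and lim_t: "(\<lambda>n. LINT x|M. (t n x - v x)\<^sup>2) \<longlonglongrightarrow> 0"
    using square_integrable_complete[OF finite_measure_M sq(3) Cauchy_t] .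
  have Cauchy_D: "\<exists>N. \<forall>i\<ge>N. \<forall>j\<ge>N. (LINT p|MM. (D (s i) p - D (s j) p)\<^sup>2) < e"
    if "e > 0" for e
  proof -
    obtain N1 where N1: "\<forall>i\<ge>N1. \<forall>j\<ge>N1. (LINT x|M. (s i x - s j x)\<^sup>2) < e / 2"
      using Cauchy_s[of "e / 2"] half_gt_zero[OF \<open>e > 0\<close>] by blast
    obtain N2 where N2: "\<forall>i\<ge>N2. \<forall>j\<ge>N2. (LINT x|M. (t i x - t j x)\<^sup>2) < e / 2"
      using Cauchy_t[of "e / 2"] half_gt_zero[OF \<open>e > 0\<close>] by blast
    have "(LINT p|MM. (D (s i) p - D (s j) p)\<^sup>2) < e"
      if "i \<ge> max N1 N2" "j \<ge> max N1 N2" for i j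
    proof -
      have "(LINT x|M. (s i x - s j x)\<^sup>2) < e / 2" "(LINT x|M. (t i x - t j x)\<^sup>2) < e / 2"
        using that N1 N2 by auto
      then show ?thesis
        using laplacian_energy_le[OF laplacian_diff[OF lap lap, of i j]] by (simp add: D_diff)
    qed
    then show ?thesis
      by blast
  qed
  have AE_D: "AE p in MM. (\<lambda>n. D (s (k n)) p) \<longlonglongrightarrow> D u p"
    using AE_restrict_square[OF domain_sets AE_s]
    by eventually_elim (auto simp: D_def intro!: tendsto_intros)
  have "D u \<in> borel_measurable MM"
    using u by measurable
  note limit_D = square_integrable_limit[OF sq(2) this Cauchy_D k AE_D]
  have "is_nl_laplacian r \<Omega> u v"
  proof (rule laplacianI)
    fix \<phi> assume \<phi>: "\<phi> \<in> H1 r \<Omega>"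
    then have sq\<phi>: "square_integrable M \<phi>" "square_integrable MM (D \<phi>)"
      by (auto simp: H1_iff)
    have "(\<lambda>n. LINT x|M. t n x * \<phi> x) \<longlonglongrightarrow> (LINT x|M. v x * \<phi> x)"
      using sq v sq\<phi> lim_t by (intro L2.form_tendsto) (auto simp: power2_eq_square)
    moreover have "(\<lambda>n. LINT p|MM. D (s n) p * D \<phi> p) \<longlonglongrightarrow> (LINT p|MM. D u p * D \<phi> p)"
      using sq limit_D sq\<phi> by (intro L2.form_tendsto) (auto simp: power2_eq_square)
    then have "(\<lambda>n. - real DIM('a) * (LINT p|MM. D (s n) p * D \<phi> p))
      \<longlonglongrightarrow> - real DIM('a) * (LINT p|MM. D u p * D \<phi> p)"
      by (intro tendsto_intros)
    ultimately show "(LINT x|M. v x * \<phi> x) = - real DIM('a) * (LINT p|MM. D u p * D \<phi> p)"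
      unfolding laplacian_weak[OF lap \<phi>] by (rule LIMSEQ_unique)
  qed (use u v limit_D in \<open>auto simp: H1_iff\<close>)
  with AE_s AE_t lim_t show thesis
    using that by blast
qed

section \<open>Density of the test functions and uniqueness of the weak Laplacian\<close>

text \<open>The squared Lipschitz bound cancels the singularity of the kernel and leaves
  \<open>L^2 * r (norm (x - y))\<close>, which is bounded because \<open>r\<close> is continuous on
  the compact interval up to the diameter of the domain.\<close>

lemma Lipschitz_bounded_H1:
  assumes lip: "\<And>x y. \<bar>\<phi> x - \<phi> y\<bar> \<le> L * norm (x - y)" and bound: "\<And>x. \<bar>\<phi> x\<bar> \<le> C"
  shows "\<phi> \<in> H1 r \<Omega>"
proof -
  interpret M: finite_measure M by (rule finite_measure_M)
  interpret MM: finite_measure MM by (rule finite_measure_MM)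
  have L: "0 \<le> L"
  proof -
    obtain b :: 'a where "b \<in> Basis"
      using nonempty_Basis by blast
    then show ?thesis
      using lip[of b 0] by simp
  qed
  have "L-lipschitz_on UNIV \<phi>"
    using lip L by (intro lipschitz_onI) (auto simp: dist_norm)
  then have "continuous_on UNIV \<phi>"
    by (rule lipschitz_on_continuous_on)
  then have [measurable]: "\<phi> \<in> borel_measurable M"
    by (intro measurable_restrict_space1) (simp add: borel_measurable_continuous_onI)
  have "integrable M (\<lambda>x. (\<phi> x)\<^sup>2)"
  proof (rule M.integrable_const_bound)
    show "AE x in M. norm ((\<phi> x)\<^sup>2) \<le> C\<^sup>2"
      using bound by (auto intro!: AE_I2 simp: abs_le_square_iff[symmetric] intro: order.trans[OF _ abs_ge_self])
  qed simp
  moreover have "integrable MM (\<lambda>p. (D \<phi> p)\<^sup>2)"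
  proof -
    define d where "d = diameter \<Omega>"
    have "compact (r ` {0..d})"
      by (intro compact_continuous_image continuous_on_subset[OF profile_continuous]) auto
    then obtain R where R: "\<And>t. 0 \<le> t \<Longrightarrow> t \<le> d \<Longrightarrow> r t \<le> R"
      using bounded_imp_bdd_above[OF compact_imp_bounded] by (force simp: bdd_above_def)
    show ?thesis
    proof (rule MM.integrable_const_bound)
      have "(D \<phi> (x, y))\<^sup>2 \<le> L\<^sup>2 * R" if "x \<in> \<Omega>" "y \<in> \<Omega>" for x y
      proof -
        have "dist x y \<le> d"
          unfolding d_def using diameter_bounded_bound[OF bounded_domain that] .
        then have r: "0 \<le> r (norm (x - y))" "r (norm (x - y)) \<le> R"
          by (auto simp: dist_norm intro!: R profile_nonneg)
        have "(D \<phi> (x, y))\<^sup>2 = \<bar>\<phi> y - \<phi> x\<bar>\<^sup>2 * (r (norm (x - y)) / (norm (x - y))\<^sup>2)"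
          by (simp add: D_def power_mult_distrib norm_alpha_squared)
        also have "\<dots> \<le> (L * norm (x - y))\<^sup>2 * (r (norm (x - y)) / (norm (x - y))\<^sup>2)"
          using lip[of y x] r(1) by (intro mult_right_mono power_mono) (auto simp: norm_minus_commute)
        also have "\<dots> \<le> L\<^sup>2 * r (norm (x - y))"
          using r(1) by (cases "x = y") (auto simp: power_mult_distrib)
        also have "\<dots> \<le> L\<^sup>2 * R"
          using r(2) by (intro mult_left_mono) auto
        finally show ?thesis .
      qed
      then show "AE p in MM. norm ((D \<phi> p)\<^sup>2) \<le> L\<^sup>2 * R"
        by (intro AE_I2) (auto simp: space_restrict_space)
    qed simp
  qed
  ultimately show ?thesis
    by (simp add: H1_iff square_integrable_def)
qed

lemma cutoff_H1:
  fixes K :: "'a set"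
  shows "(\<lambda>x. max 0 (1 - real n * infdist x K)) \<in> H1 r \<Omega>"
proof (rule Lipschitz_bounded_H1)
  fix x y :: 'a
  have "\<bar>max 0 (1 - real n * infdist x K) - max 0 (1 - real n * infdist y K)\<bar>
      \<le> \<bar>real n * (infdist x K - infdist y K)\<bar>"
    by (auto simp: max_def abs_if algebra_simps)
  also have "\<dots> \<le> real n * norm (x - y)"
    using infdist_triangle_abs[of x K y] by (auto simp: abs_mult dist_norm intro!: mult_left_mono)
  finally show "\<bar>max 0 (1 - real n * infdist x K) - max 0 (1 - real n * infdist y K)\<bar>
      \<le> real n * norm (x - y)" .
  show "\<bar>max 0 (1 - real n * infdist x K)\<bar> \<le> 1"
    by (simp add: infdist_nonneg)
qed

text \<open>Off the closed set \<open>K\<close> the distance to \<open>K\<close> is positive, so the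
  cutoff is 0 once \<open>n\<close> is large; on \<open>K\<close> it is constantly 1.\<close>

lemma cutoff_tendsto_indicator:
  fixes K :: "'a set"
  assumes "closed K" "K \<noteq> {}"
  shows "(\<lambda>n. max 0 (1 - real n * infdist x K)) \<longlonglongrightarrow> indicator K x"
proof (cases "x \<in> K")
  case False
  then have "0 < infdist x K"
    using infdist_pos_not_in_closed[OF assms] by blast
  then obtain N where N: "1 < real N * infdist x K"
    using ex_less_of_nat_mult by blast
  have "max 0 (1 - real n * infdist x K) = 0" if "n \<ge> N" for n
  proof -
    have "real N * infdist x K \<le> real n * infdist x K"
      using that by (intro mult_right_mono) (auto simp: infdist_nonneg)
    then show ?thesis
      using N by simp
  qed
  then show ?thesis
    using False by (intro tendsto_eventually) (auto simp: eventually_sequentially)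
qed simp

text \<open>Testing with cutoffs and letting their slope grow shows that the extension
  \<open>g\<close> of \<open>w\<close> by zero has integral 0 over every closed set. Closed sets
  form an intersection-stable generator of the Borel sets, so Dynkin's argument extends this to all
  Borel sets.\<close>

lemma H1_dense:
  assumes w: "square_integrable M w"
    and orth: "\<And>\<phi>. \<phi> \<in> H1 r \<Omega> \<Longrightarrow> (LINT x|M. w x * \<phi> x) = 0"
  shows "AE x in M. w x = 0"
proof -
  define g where "g x = indicator \<Omega> x * w x" for x
  have "integrable M w"
    by (rule finite_measure.square_integrable_imp_integrable[OF finite_measure_M])
      (use w in \<open>simp_all add: square_integrable_def\<close>)
  then have g: "integrable lborel g"
    by (simp add: g_def[abs_def] integrable_restrict_space)
  then have [measurable]: "g \<in> borel_measurable borel"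
    by auto
  have closed: "(LINT x:K|lborel. g x) = 0" if "closed K" for K
  proof (cases "K = {}")
    case False
    have [measurable]: "K \<in> sets borel"
      using that by simp
    have [measurable]: "(\<lambda>x. infdist x K) \<in> borel_measurable borel"
      by (intro borel_measurable_continuous_onI continuous_intros)
    have "(\<lambda>n. LINT x|lborel. g x * max 0 (1 - real n * infdist x K))
        \<longlonglongrightarrow> (LINT x|lborel. g x * indicator K x)"
    proof (rule integral_dominated_convergence)
      show "integrable lborel (\<lambda>x. \<bar>g x\<bar>)"
        using g by simp
      show "AE x in lborel. (\<lambda>n. g x * max 0 (1 - real n * infdist x K)) \<longlonglongrightarrow> g x * indicator K x"
        using cutoff_tendsto_indicator[OF that False] by (intro AE_I2 tendsto_intros)
      show "AE x in lborel. norm (g x * max 0 (1 - real n * infdist x K)) \<le> \<bar>g x\<bar>" for n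
        by (intro AE_I2) (auto simp: abs_mult infdist_nonneg intro!: mult_left_le)
    qed measurable
    moreover have "(LINT x|lborel. g x * max 0 (1 - real n * infdist x K)) = 0" for n
      using orth[OF cutoff_H1[of n K]] by (simp add: g_def integral_restrict_space mult.assoc)
    ultimately show ?thesis
      by (simp add: set_lebesgue_integral_def mult.commute LIMSEQ_const_iff)
  qed (simp add: set_lebesgue_integral_def)
  have "(LINT x:A|lborel. g x) = 0" if "A \<in> sets borel" for A
  proof -
    have "Int_stable (Collect closed :: 'a set set)" "Collect closed \<subseteq> Pow (UNIV :: 'a set)"
      "A \<in> sigma_sets UNIV (Collect closed)"
      using that by (auto simp: Int_stable_def borel_eq_closed)
    then show ?thesis
    proof (induction rule: sigma_sets_induct_disjoint)
      case (compl A)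
      then have [measurable]: "A \<in> sets borel"
        by (simp add: borel_eq_closed)
      have "(LINT x:UNIV - A|lborel. g x) = (LINT x|lborel. g x - indicator A x * g x)"
        unfolding set_lebesgue_integral_def
        by (intro Bochner_Integration.integral_cong) (auto simp: indicator_def)
      also have "\<dots> = (LINT x|lborel. g x) - (LINT x:A|lborel. g x)"
        using g integrable_real_mult_indicator[of A lborel g]
        by (simp add: set_lebesgue_integral_def mult.commute)
      \<comment> \<open>The whole space is closed, so the total integral vanishes and complements
        inherit the property.\<close>
      finally show ?case
        using closed[of UNIV] compl by (simp add: set_lebesgue_integral_def)
    next
      case (union A)
      then have "range A \<subseteq> sets borel"
        by (simp add: borel_eq_closed)
      then have A: "A i \<in> sets lborel" for i
        by auto
      have "set_integrable lborel (\<Union>i. A i) g"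
        unfolding set_integrable_def using A g by (intro integrable_mult_indicator) auto
      then have "(LINT x:(\<Union>i. A i)|lborel. g x) = (\<Sum>i. LINT x:A i|lborel. g x)"
        using union(1) A by (intro lebesgue_integral_countable_add) (auto simp: disjoint_family_on_def)
      then show ?case
        using union by simp
    qed (auto simp: closed)
  qed
  then have "AE x in lborel. g x = 0"
    using density_unique_real[OF g, of "\<lambda>x. 0"] by simp
  then show ?thesis
    by (simp add: AE_restrict_space_iff g_def) (auto elim!: eventually_mono)
qed

text \<open>The difference of two versions is orthogonal to all of \<open>H1\<close>. This is what
  makes the choice in \<open>nl_laplacian\<close> harmless.\<close>

lemma laplacian_unique:
  assumes v: "is_nl_laplacian r \<Omega> u v" and w: "is_nl_laplacian r \<Omega> u w"
  shows "AE x in M. v x = w x"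
proof -
  have "AE x in M. v x - w x = 0"
  proof (rule H1_dense)
    fix \<phi> assume \<phi>: "\<phi> \<in> H1 r \<Omega>"
    then have "square_integrable M \<phi>"
      by (simp add: H1_iff)
    then have "(LINT x|M. (v x - w x) * \<phi> x) = (LINT x|M. v x * \<phi> x) - (LINT x|M. w x * \<phi> x)"
      using v w by (intro L2.form_diff) (auto intro: laplacian_square_integrable)
    then show "(LINT x|M. (v x - w x) * \<phi> x) = 0"
      using laplacian_weak[OF v \<phi>] laplacian_weak[OF w \<phi>] by simp
  qed (intro square_integrable_diff laplacian_square_integrable(3)[OF v]
      laplacian_square_integrable(3)[OF w])
  then show ?thesis
    by simp
qed

subsection \<open>Poincare inequality\<close>

text \<open>The translation estimate is averaged over a ball \<open>A\<close> of vectors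
  \<open>h\<close> whose lengths lie in an interval where \<open>r\<close> is at least
  \<open>c > 0\<close>. After \<open>y = x + h\<close> the averaged increments form a double
  integral controlled by the energy.\<close>

lemma Poincare:
  assumes [measurable]: "S \<in> sets borel" and t: "0 < t" "0 < r t"
    and collar: "\<And>x. x \<in> S \<Longrightarrow> cball x t \<subseteq> \<Omega>"
  obtains C where "0 \<le> C"
    "\<And>u. u \<in> H1 r \<Omega> \<Longrightarrow> AE x in M. x \<notin> S \<longrightarrow> u x = 0 \<Longrightarrow>
      (LINT x|M. (u x)\<^sup>2) \<le> C * (LINT p|MM. (D u p)\<^sup>2)"
proof -
  have S_subset: "S \<subseteq> \<Omega>"
    using collar t by fastforce
  obtain e where e: "0 < e" "\<And>s. 0 \<le> s \<Longrightarrow> \<bar>s - t\<bar> < e \<Longrightarrow> \<bar>r s - r t\<bar> < r t / 2"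
    using profile_continuous[unfolded continuous_on_iff, rule_format, of t "r t / 2"] t
    by (auto simp: dist_real_def)
  define c where "c = r t / 2"
  \<comment> \<open>Lengths in \<open>[a, t]\<close> are positive and within \<open>e\<close> of
    \<open>t\<close>, so \<open>r\<close> is at least \<open>c\<close> there; they do not exceed
    \<open>t\<close>, as the collar condition demands.\<close>
  define a where "a = max (t / 2) (t - e / 2)"
  have a: "0 < a" "a < t" and c: "0 < c"
    using t e(1) by (auto simp: a_def c_def)
  have r_ge: "c \<le> r s" if "a \<le> s" "s \<le> t" for s
  proof -
    have "0 \<le> s" "\<bar>s - t\<bar> < e"
      using that a e(1) by (auto simp: a_def)
    then show ?thesis
      using e(2)[of s] unfolding c_def by linarith
  qed
  obtain b :: 'a where b: "b \<in> Basis"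
    using nonempty_Basis by blast
  \<comment> \<open>A ball of positive measure inside the shell of vectors with length between
    \<open>a\<close> and \<open>t\<close>.\<close>
  define A where "A = ball (((a + t) / 2) *\<^sub>R b) ((t - a) / 2)"
  have norm_A: "a \<le> norm h" "norm h \<le> t" if "h \<in> A" for h
  proof -
    let ?h = "((a + t) / 2) *\<^sub>R b"
    have "norm (?h - h) < (t - a) / 2" "norm ?h = (a + t) / 2"
      using that b a by (auto simp: A_def dist_norm)
    moreover have "norm ?h \<le> norm (?h - h) + norm h" "norm h \<le> norm ?h + norm (?h - h)"
      using norm_triangle_sub[of ?h h] norm_triangle_sub[of h ?h] by (auto simp: norm_minus_commute)
    ultimately show "a \<le> norm h" "norm h \<le> t"
      by argo+
  qed
  have [measurable]: "A \<in> sets borel"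
    by (simp add: A_def)
  define m where "m = measure lborel A"
  have "emeasure lborel A < \<infinity>"
    unfolding A_def by (intro emeasure_bounded_finite bounded_ball)
  then have A_m: "emeasure lborel A = ennreal m"
    by (simp add: m_def emeasure_eq_ennreal_measure top.not_eq_extremum)
  have m: "0 < m"
    unfolding m_def A_def using a by (simp add: content_ball_pos)
  obtain R where R: "\<And>x. x \<in> S \<Longrightarrow> norm x \<le> R"
    using bounded_subset[OF bounded_domain S_subset] by (auto simp: bounded_iff)
  \<comment> \<open>Choosing \<open>N\<close> from the lower bound \<open>a\<close> makes the same
    number of steps work for every \<open>h\<close> in \<open>A\<close>.\<close>
  obtain N where N: "2 * R < real N * a"
    using ex_less_of_nat_mult[OF a(1)] by blast
  \<comment> \<open>\<open>N^2\<close> comes from the translation estimate, and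
    \<open>c / t^2\<close> is a lower bound for the kernel on the shell.\<close>
  define K where "K = (real N)\<^sup>2 * (t\<^sup>2 / c)"
  have K: "0 \<le> K"
    using c by (simp add: K_def)
  have "(LINT x|M. (u x)\<^sup>2) \<le> K / m * (LINT p|MM. (D u p)\<^sup>2)"
    if u: "u \<in> H1 r \<Omega>" and supp: "AE x in M. x \<notin> S \<longrightarrow> u x = 0" for u
  proof -
    have sq: "square_integrable M u" "square_integrable MM (D u)"
      using u by (auto simp: H1_iff)
    \<comment> \<open>A globally Borel version of \<open>u\<close> that vanishes everywhere off
      \<open>S\<close>, as the pointwise telescoping requires.\<close>
    define g where "g x = indicator S x * u x" for x
    have g_eq: "g x = indicator S x * (indicator \<Omega> x *\<^sub>R u x)" for x
      using S_subset by (auto simp: g_def indicator_def)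
    have "(\<lambda>x. indicator \<Omega> x *\<^sub>R u x) \<in> borel_measurable lborel"
      using sq(1) by (subst borel_measurable_restrict_space_iff[symmetric])
        (auto simp: square_integrable_def)
    then have [measurable]: "g \<in> borel_measurable borel"
      unfolding g_eq by simp
    have g_off: "g x = 0" if "x \<notin> S" for x
      using that by (simp add: g_def)
    have AE_g: "AE x in M. g x = u x"
      using supp by eventually_elim (auto simp: g_def indicator_def)
    have [measurable]: "D g \<in> borel_measurable borel"
      unfolding D_def borel_prod[symmetric] by (measurable, simp add: borel_prod)
    let ?I = "\<integral>\<^sup>+x. ennreal ((g x)\<^sup>2) \<partial>lborel"
    have "(\<integral>\<^sup>+x. ennreal ((u x)\<^sup>2) \<partial>M) = (\<integral>\<^sup>+x. ennreal ((g x)\<^sup>2) \<partial>M)"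
      using AE_g by (intro nn_integral_cong_AE) (auto elim!: eventually_mono)
    also have "\<dots> = (\<integral>\<^sup>+x. ennreal ((g x)\<^sup>2) * indicator \<Omega> x \<partial>lborel)"
      by (simp add: nn_integral_restrict_space)
    also have "\<dots> = ?I"
      using S_subset g_off by (intro nn_integral_cong) (auto simp: indicator_def)
    finally have I: "?I = ennreal (LINT x|M. (u x)\<^sup>2)"
      using sq(1) by (simp add: nn_integral_eq_integral square_integrable_def)
    have "(\<integral>\<^sup>+p. ennreal ((D u p)\<^sup>2) \<partial>MM) = (\<integral>\<^sup>+p. ennreal ((D g p)\<^sup>2) \<partial>MM)"
      using AE_restrict_square[OF domain_sets AE_g]
      by (intro nn_integral_cong_AE) (auto simp: D_def simp del: AE_conj_iff elim!: eventually_mono)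
    moreover have "(\<integral>\<^sup>+p. ennreal ((D u p)\<^sup>2) \<partial>MM) = ennreal (LINT p|MM. (D u p)\<^sup>2)"
      using sq(2) by (intro nn_integral_eq_integral) (auto simp: square_integrable_def)
    ultimately have E: "(\<integral>\<^sup>+p. ennreal ((D g p)\<^sup>2) * indicator (\<Omega> \<times> \<Omega>) p \<partial>lborel)
        = ennreal (LINT p|MM. (D u p)\<^sup>2)"
      by (simp add: nn_integral_restrict_space)
    \<comment> \<open>A nonzero increment puts \<open>x\<close> or \<open>y\<close> in
      \<open>S\<close>. The other point is within \<open>t\<close> of it, so the collar keeps both
      in \<Omega> and the pair is counted by the energy.\<close>
    have pointwise: "indicator A (- x + y) * ennreal ((g y - g x)\<^sup>2)
        \<le> ennreal (t\<^sup>2 / c) * (ennreal ((D g (x, y))\<^sup>2) * indicator (\<Omega> \<times> \<Omega>) (x, y))" for x y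
    proof (cases "- x + y \<in> A \<and> g y \<noteq> g x")
      case True
      then have n: "a \<le> norm (x - y)" "norm (x - y) \<le> t"
        using norm_A[of "- x + y"] by (auto simp: norm_minus_commute)
      have "x \<in> S \<or> y \<in> S"
        using True g_off by metis
      then have "x \<in> \<Omega>" "y \<in> \<Omega>"
        using collar[of x] collar[of y] n(2) t(1) by (auto simp: dist_norm norm_minus_commute subset_iff)
      moreover have "(g y - g x)\<^sup>2 \<le> t\<^sup>2 / c * (D g (x, y))\<^sup>2"
      proof -
        have "c / t\<^sup>2 \<le> r (norm (x - y)) / (norm (x - y))\<^sup>2"
          using n a(1) c r_ge[OF n] by (intro frac_le power_mono) auto
        then have "(g y - g x)\<^sup>2 * (c / t\<^sup>2) \<le> (D g (x, y))\<^sup>2"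
          by (simp add: D_def power_mult_distrib norm_alpha_squared mult_left_mono
              del: times_divide_eq_right)
        then show ?thesis
          using t(1) c by (simp add: field_simps)
      qed
      ultimately show ?thesis
        using True c by (simp add: ennreal_mult'[symmetric] ennreal_leI)
    qed auto
    \<comment> \<open>Average over \<open>h\<close> in \<open>A\<close>, exchange the integrals, and
      substitute \<open>y = x + h\<close> by translation invariance.\<close>
    have "ennreal m * ?I = (\<integral>\<^sup>+h. indicator A h * ?I \<partial>lborel)"
      by (simp add: nn_integral_multc A_m)
    also have "\<dots> \<le> (\<integral>\<^sup>+h. ennreal ((real N)\<^sup>2) *
        (\<integral>\<^sup>+x. indicator A h * ennreal ((g (x + h) - g x)\<^sup>2) \<partial>lborel) \<partial>lborel)"
    proof (rule nn_integral_mono)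
      fix h
      show "indicator A h * ?I \<le> ennreal ((real N)\<^sup>2) *
        (\<integral>\<^sup>+x. indicator A h * ennreal ((g (x + h) - g x)\<^sup>2) \<partial>lborel)"
      proof (cases "h \<in> A")
        case True
        then have "2 * R < real N * norm h"
          using N mult_left_mono[OF norm_A(1)[OF True], of "real N"] by linarith
        from nn_integral_square_le_increment[of g, OF _ g_off R this] show ?thesis
          using True by simp
      qed simp
    qed
    also have "\<dots> = ennreal ((real N)\<^sup>2) *
        (\<integral>\<^sup>+h. \<integral>\<^sup>+x. indicator A h * ennreal ((g (x + h) - g x)\<^sup>2) \<partial>lborel \<partial>lborel)"
      by (rule nn_integral_cmult) measurable
    also have "(\<integral>\<^sup>+h. \<integral>\<^sup>+x. indicator A h * ennreal ((g (x + h) - g x)\<^sup>2) \<partial>lborel \<partial>lborel)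
        = (\<integral>\<^sup>+x. \<integral>\<^sup>+h. indicator A h * ennreal ((g (x + h) - g x)\<^sup>2) \<partial>lborel \<partial>lborel)"
      by (rule lborel_pair.Fubini') measurable
    also have "\<dots> = (\<integral>\<^sup>+x. \<integral>\<^sup>+y. indicator A (- x + y) * ennreal ((g y - g x)\<^sup>2) \<partial>lborel \<partial>lborel)"
    proof (rule nn_integral_cong)
      fix x :: 'a
      show "(\<integral>\<^sup>+h. indicator A h * ennreal ((g (x + h) - g x)\<^sup>2) \<partial>lborel)
          = (\<integral>\<^sup>+y. indicator A (- x + y) * ennreal ((g y - g x)\<^sup>2) \<partial>lborel)"
        by (subst nn_integral_lborel_translation[of _ "- x", symmetric]) auto
    qed
    also have "\<dots> \<le> (\<integral>\<^sup>+x. \<integral>\<^sup>+y. ennreal (t\<^sup>2 / c) *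
        (ennreal ((D g (x, y))\<^sup>2) * indicator (\<Omega> \<times> \<Omega>) (x, y)) \<partial>lborel \<partial>lborel)"
      by (intro nn_integral_mono pointwise)
    also have "\<dots> = (\<integral>\<^sup>+p. ennreal (t\<^sup>2 / c) *
        (ennreal ((D g p)\<^sup>2) * indicator (\<Omega> \<times> \<Omega>) p) \<partial>lborel)"
      unfolding lborel_prod[symmetric, where 'a='a and 'b='a]
      by (rule lborel.nn_integral_fst) (simp add: lborel_prod)
    also have "\<dots> = ennreal (t\<^sup>2 / c) * ennreal (LINT p|MM. (D u p)\<^sup>2)"
      by (subst nn_integral_cmult) (auto simp: E)
    finally have "ennreal m * ennreal (LINT x|M. (u x)\<^sup>2)
        \<le> ennreal ((real N)\<^sup>2) * (ennreal (t\<^sup>2 / c) * ennreal (LINT p|MM. (D u p)\<^sup>2))"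
      by (simp add: I mult_left_mono)
    also have "\<dots> = ennreal (K * (LINT p|MM. (D u p)\<^sup>2))"
      using c by (simp add: K_def ennreal_mult'[symmetric] mult.assoc)
    finally have "m * (LINT x|M. (u x)\<^sup>2) \<le> K * (LINT p|MM. (D u p)\<^sup>2)"
      using m K by (simp add: ennreal_mult'[symmetric])
    then show ?thesis
      using m by (simp add: field_simps)
  qed
  then show thesis
    using that[of "K / m"] K m by simp
qed

text \<open>With the energy identity, the Poincare bound becomes \<open>?a <= C * (- ?p)\<close>.
  Squaring and Cauchy-Schwarz give \<open>?a^2 <= C^2 * ?a * ?b\<close>, and \<open>?a\<close>
  cancels unless it is 0.\<close>

lemma laplacian_coercive:
  assumes uv: "is_nl_laplacian r \<Omega> u v" and C: "0 \<le> C"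
    and le: "(LINT x|M. (u x)\<^sup>2) \<le> C * (LINT p|MM. (D u p)\<^sup>2)"
  shows "(LINT x|M. (u x)\<^sup>2) \<le> C\<^sup>2 * (LINT x|M. (v x)\<^sup>2)"
proof -
  let ?a = "LINT x|M. (u x)\<^sup>2" and ?b = "LINT x|M. (v x)\<^sup>2" and ?p = "LINT x|M. u x * v x"
  have "1 \<le> real DIM('a)"
    by (simp add: Suc_leI)
  then have "(LINT p|MM. (D u p)\<^sup>2) \<le> real DIM('a) * (LINT p|MM. (D u p)\<^sup>2)"
    using mult_right_mono[of 1 "real DIM('a)" "LINT p|MM. (D u p)\<^sup>2"] by simp
  also have "\<dots> = - ?p"
    by (rule laplacian_energy[OF uv])
  finally have "?a \<le> C * (- ?p)"
    using le C by (meson mult_left_mono order.trans)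
  then have "?a\<^sup>2 \<le> (C * (- ?p))\<^sup>2"
    by (intro power_mono) auto
  also have "\<dots> = C\<^sup>2 * ?p\<^sup>2"
    by (simp add: power_mult_distrib)
  also have "\<dots> \<le> C\<^sup>2 * (?a * ?b)"
    using L2.form_Cauchy_Schwarz[of u M v] laplacian_square_integrable[OF uv]
    by (intro mult_left_mono) (auto simp: power2_eq_square)
  finally have "?a * ?a \<le> ?a * (C\<^sup>2 * ?b)"
    by (simp add: power2_eq_square mult.left_commute)
  moreover have "0 \<le> ?a" "0 \<le> C\<^sup>2 * ?b"
    by auto
  ultimately show ?thesis
    by (cases "?a = 0") auto
qed

subsection \<open>The hinged and the clamped space\<close>

lemma is_nl_laplacian_nl_laplacian:
  "u \<in> H2 r \<Omega> \<Longrightarrow> is_nl_laplacian r \<Omega> u (nl_laplacian r \<Omega> u)"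
  
  using someI_ex[of "is_nl_laplacian r \<Omega> u"] by (simp add: H2_def nl_laplacian_def)

lemma laplacian_H2: "is_nl_laplacian r \<Omega> u v \<Longrightarrow> u \<in> H2 r \<Omega>"
  by (auto simp: H2_def laplacian_H1)

lemma nl_laplacian_AE_eq:
  "is_nl_laplacian r \<Omega> u v \<Longrightarrow> AE x in M. nl_laplacian r \<Omega> u x = v x"
  using laplacian_unique is_nl_laplacian_nl_laplacian laplacian_H2 by blast

text \<open>Common form of the hinged and the clamped space: side conditions that are linear and
  pointwise a.e. in \<open>u\<close> and in its Laplacian, hence stable under a.e. limits.\<close>

definition constrained_space :: "('a \<Rightarrow> real) \<Rightarrow> ('a \<Rightarrow> real) \<Rightarrow> ('a \<Rightarrow> real) set" where
  "constrained_space p q =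
    {u \<in> H2 r \<Omega>. AE x in M. p x * u x = 0 \<and> q x * nl_laplacian r \<Omega> u x = 0}"

text \<open>The condition may be checked on any version of the Laplacian; for combinations and
  limits the natural version need not be the chosen one.\<close>

lemma constrained_spaceI:
  assumes "is_nl_laplacian r \<Omega> u v" "AE x in M. p x * u x = 0" "AE x in M. q x * v x = 0"
  shows "u \<in> constrained_space p q"
  using nl_laplacian_AE_eq[OF assms(1)] assms laplacian_H2[OF assms(1)]
  unfolding constrained_space_def by (auto elim!: eventually_elim2)

lemma constrained_spaceD:
  assumes "u \<in> constrained_space p q"
  shows "is_nl_laplacian r \<Omega> u (nl_laplacian r \<Omega> u)"
    "AE x in M. p x * u x = 0" "AE x in M. q x * nl_laplacian r \<Omega> u x = 0"
  using assms by (auto simp: constrained_space_def is_nl_laplacian_nl_laplacian)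

definition biform :: "('a \<Rightarrow> real) \<Rightarrow> ('a \<Rightarrow> real) \<Rightarrow> real" where
  "biform u v = (LINT x|M. nl_laplacian r \<Omega> u x * nl_laplacian r \<Omega> v x)"

lemma biform_eq:
  assumes "is_nl_laplacian r \<Omega> u u'" "is_nl_laplacian r \<Omega> v v'"
  shows "biform u v = (LINT x|M. u' x * v' x)"
proof -
  have meas: "w \<in> borel_measurable M" if "is_nl_laplacian r \<Omega> z w" for z w
    using laplacian_square_integrable(3)[OF that] by (simp add: square_integrable_def)
  note meas[OF assms(1), measurable] meas[OF assms(2), measurable]
    meas[OF is_nl_laplacian_nl_laplacian[OF laplacian_H2[OF assms(1)]], measurable]
    meas[OF is_nl_laplacian_nl_laplacian[OF laplacian_H2[OF assms(2)]], measurable]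
  show ?thesis
    unfolding biform_def
    using nl_laplacian_AE_eq[OF assms(1)] nl_laplacian_AE_eq[OF assms(2)]
    by (intro integral_cong_AE) (measurable, auto elim!: eventually_elim2)
qed

lemma constrained_space_comb:
  assumes u: "u \<in> constrained_space p q" and v: "v \<in> constrained_space p q"
  shows "(\<lambda>x. u x + c * v x) \<in> constrained_space p q"
proof (rule constrained_spaceI[OF laplacian_comb])
  show "AE x in M. p x * (u x + c * v x) = 0"
    using constrained_spaceD(2)[OF u] constrained_spaceD(2)[OF v]
    by eventually_elim (auto simp: distrib_left)
  show "AE x in M. q x * (nl_laplacian r \<Omega> u x + c * nl_laplacian r \<Omega> v x) = 0"
    using constrained_spaceD(3)[OF u] constrained_spaceD(3)[OF v]
    by eventually_elim (auto simp: distrib_left)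
qed (use u v in \<open>auto intro: constrained_spaceD\<close>)

sublocale constrained: semi_inner_space "constrained_space p q" biform for p q
proof
  show "(\<lambda>x. 0) \<in> constrained_space p q"
    by (rule constrained_spaceI[OF laplacian_zero]) auto
  fix u v w c
  assume u: "u \<in> constrained_space p q" and v: "v \<in> constrained_space p q"
  show "(\<lambda>x. u x + c * v x) \<in> constrained_space p q"
    using u v by (rule constrained_space_comb)
  note lap = constrained_spaceD(1)
  assume w: "w \<in> constrained_space p q"
  \<comment> \<open>The chosen Laplacian is linear only up to null sets, so linearity is read off
    from the combined version through \<open>biform_eq\<close>.\<close>
  show "biform (\<lambda>x. u x + c * v x) w = biform u w + c * biform v w"
    unfolding biform_eq[OF laplacian_comb[OF lap[OF u] lap[OF v]] lap[OF w]]
    unfolding biform_def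
    by (rule L2.form_comb) (use u v w in \<open>auto intro: laplacian_square_integrable lap\<close>)
qed (auto simp: biform_def mult.commute)

section \<open>Completeness of the energy form and well-posedness\<close>

text \<open>Cauchy in the form means that the Laplacians are Cauchy in L2; coercivity then makes the
  functions Cauchy, and closedness of the Laplacian supplies the limit. The side conditions survive
  along the a.e. convergent subsequences.\<close>

lemma constrained_space_complete:
  assumes C: "0 \<le> C"
    and Poincare: "\<And>u. u \<in> constrained_space p q \<Longrightarrow>
      (LINT x|M. (u x)\<^sup>2) \<le> C * (LINT p|MM. (D u p)\<^sup>2)"
    and s: "\<And>n. s n \<in> constrained_space p q"
    and Cauchy: "\<And>e. e > 0 \<Longrightarrow>
      \<exists>N. \<forall>i\<ge>N. \<forall>j\<ge>N. biform (\<lambda>x. s i x - s j x) (\<lambda>x. s i x - s j x) < e"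
  shows "\<exists>u\<in>constrained_space p q. (\<lambda>n. biform (\<lambda>x. s n x - u x) (\<lambda>x. s n x - u x)) \<longlonglongrightarrow> 0"
proof -
  let ?t = "\<lambda>n. nl_laplacian r \<Omega> (s n)"
  note lap = constrained_spaceD(1)[OF s]
  have biform_diff: "biform (\<lambda>x. s i x - s j x) (\<lambda>x. s i x - s j x) = (LINT x|M. (?t i x - ?t j x)\<^sup>2)"
    for i j
    using biform_eq[OF laplacian_diff[OF lap lap] laplacian_diff[OF lap lap]]
    by (simp add: power2_eq_square)
  have Cauchy_t: "\<exists>N. \<forall>i\<ge>N. \<forall>j\<ge>N. (LINT x|M. (?t i x - ?t j x)\<^sup>2) < e" if "e > 0" for e
    using Cauchy[OF that] by (simp add: biform_diff)
  have Cauchy_s: "\<exists>N. \<forall>i\<ge>N. \<forall>j\<ge>N. (LINT x|M. (s i x - s j x)\<^sup>2) < e" if "e > 0" for e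
  proof -
    \<comment> \<open>Adding 1 keeps the divisor positive when \<open>C = 0\<close>.\<close>
    have pos: "0 < e / (C\<^sup>2 + 1)"
      using that by (intro divide_pos_pos) (auto simp: add_nonneg_pos)
    have "(LINT x|M. (s i x - s j x)\<^sup>2) < e"
      if "(LINT x|M. (?t i x - ?t j x)\<^sup>2) < e / (C\<^sup>2 + 1)" for i j
    proof -
      have "(LINT x|M. (s i x - s j x)\<^sup>2) \<le> C\<^sup>2 * (LINT x|M. (?t i x - ?t j x)\<^sup>2)"
        using laplacian_coercive[OF laplacian_diff[OF lap lap] C Poincare[OF constrained.diff_mem[OF s s]]] .
      also have "\<dots> \<le> (C\<^sup>2 + 1) * (LINT x|M. (?t i x - ?t j x)\<^sup>2)"
        by (intro mult_right_mono) auto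
      also have "\<dots> < e"
        using that by (simp add: pos_less_divide_eq add_nonneg_pos mult.commute)
      finally show ?thesis .
    qed
    then show ?thesis
      using Cauchy_t[OF pos] by blast
  qed
  obtain u v k l where uv: "is_nl_laplacian r \<Omega> u v"
    and AE_s: "AE x in M. (\<lambda>n. s (k n) x) \<longlonglongrightarrow> u x"
    and AE_t: "AE x in M. (\<lambda>n. ?t (l n) x) \<longlonglongrightarrow> v x"
    and lim: "(\<lambda>n. LINT x|M. (?t n x - v x)\<^sup>2) \<longlonglongrightarrow> 0"
    using laplacian_complete[OF lap Cauchy_s Cauchy_t] .
  have "u \<in> constrained_space p q"
  proof (rule constrained_spaceI[OF uv])
    have "AE x in M. \<forall>n. p x * s n x = 0" "AE x in M. \<forall>n. q x * ?t n x = 0"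
      unfolding AE_all_countable using constrained_spaceD(2,3)[OF s] by blast+
    note AE = this
    show "AE x in M. p x * u x = 0"
      using AE(1) AE_s
    proof eventually_elim
      case (elim x)
      from tendsto_mult_left[OF elim(2), of "p x"] show ?case
        using elim(1) by (simp add: LIMSEQ_const_iff)
    qed
    show "AE x in M. q x * v x = 0"
      using AE(2) AE_t
    proof eventually_elim
      case (elim x)
      from tendsto_mult_left[OF elim(2), of "q x"] show ?case
        using elim(1) by (simp add: LIMSEQ_const_iff)
    qed
  qed
  moreover have "biform (\<lambda>x. s n x - u x) (\<lambda>x. s n x - u x) = (LINT x|M. (?t n x - v x)\<^sup>2)" for n
    using biform_eq[OF laplacian_diff[OF lap uv] laplacian_diff[OF lap uv]]
    by (simp add: power2_eq_square)
  ultimately show ?thesis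
    using lim by (intro bexI[of _ u]) (simp_all only:)
qed

text \<open>Coercivity is used twice: it bounds the load functional for the Riesz argument, and it
  shows that the difference of two solutions, whose form vanishes, is 0 a.e.\<close>

lemma biharmonic_well_posed:
  assumes C: "0 \<le> C"
    and Poincare: "\<And>u. u \<in> constrained_space p q \<Longrightarrow>
      (LINT x|M. (u x)\<^sup>2) \<le> C * (LINT p|MM. (D u p)\<^sup>2)"
    and f: "square_integrable M f"
  shows "\<exists>u\<in>constrained_space p q. (\<forall>v\<in>constrained_space p q. biform u v = (LINT x|M. f x * v x)) \<and>
    (\<forall>w\<in>constrained_space p q. (\<forall>v\<in>constrained_space p q. biform w v = (LINT x|M. f x * v x)) \<longrightarrow>
      (AE x in M. w x = u x))"
proof -
  let ?H = "constrained_space p q"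
  let ?F = "\<lambda>v. LINT x|M. f x * v x"
  have sq: "square_integrable M u" if "u \<in> ?H" for u
    using constrained_spaceD(1)[OF that] laplacian_square_integrable by blast
  have coercive: "(LINT x|M. (u x)\<^sup>2) \<le> C\<^sup>2 * biform u u" if "u \<in> ?H" for u
    using laplacian_coercive[OF constrained_spaceD(1)[OF that] C Poincare[OF that]]
    by (simp add: biform_def power2_eq_square)
  have "\<exists>u\<in>?H. \<forall>v\<in>?H. biform u v = ?F v"
  proof (rule constrained.Riesz_representation)
    show "0 \<le> C\<^sup>2 * (LINT x|M. (f x)\<^sup>2)"
      by simp
    fix u assume u: "u \<in> ?H"
    show "?F (\<lambda>x. u x + c * v x) = ?F u + c * ?F v" if "v \<in> ?H" for v c
      using L2.form_comb[of u M v f c] sq[OF u] sq[OF that] f by (simp add: mult.commute)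
    have "(?F u)\<^sup>2 \<le> (LINT x|M. (f x)\<^sup>2) * (LINT x|M. (u x)\<^sup>2)"
      using L2.form_Cauchy_Schwarz[of f M u] f sq[OF u] by (simp add: power2_eq_square)
    also have "\<dots> \<le> (LINT x|M. (f x)\<^sup>2) * (C\<^sup>2 * biform u u)"
      using coercive[OF u] by (intro mult_left_mono) auto
    finally show "(?F u)\<^sup>2 \<le> C\<^sup>2 * (LINT x|M. (f x)\<^sup>2) * biform u u"
      by (simp add: mult.left_commute mult.assoc)
  next
    fix s :: "nat \<Rightarrow> 'a \<Rightarrow> real"
    assume "\<And>n. s n \<in> ?H" and "\<And>e. e > 0 \<Longrightarrow>
      \<exists>N. \<forall>m\<ge>N. \<forall>n\<ge>N. biform (\<lambda>x. s m x - s n x) (\<lambda>x. s m x - s n x) < e"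
    then show "\<exists>u\<in>?H. (\<lambda>n. biform (\<lambda>x. s n x - u x) (\<lambda>x. s n x - u x)) \<longlonglongrightarrow> 0"
      using constrained_space_complete[OF C Poincare] by blast
  qed
  then obtain u where u: "u \<in> ?H" and sol: "\<And>v. v \<in> ?H \<Longrightarrow> biform u v = ?F v"
    by blast
  have "AE x in M. w x = u x" if w: "w \<in> ?H" and "\<forall>v\<in>?H. biform w v = ?F v" for w
  proof -
    let ?z = "\<lambda>x. w x - u x"
    have z: "?z \<in> ?H"
      using w u by (rule constrained.diff_mem)
    have "biform ?z ?z = 0"
      using constrained.form_diff[OF w u z] that(2) z sol by simp
    then have "(LINT x|M. (?z x)\<^sup>2) = 0"
      using coercive[OF z] by (intro antisym) auto
    moreover have "integrable M (\<lambda>x. (?z x)\<^sup>2)"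
      using sq[OF z] by (simp add: square_integrable_def)
    ultimately have "AE x in M. (?z x)\<^sup>2 = 0"
      by (subst (asm) integral_nonneg_eq_0_iff_AE) auto
    then show ?thesis
      by simp
  qed
  then show ?thesis
    using u sol by blast
qed

section \<open>The hinged and clamped conditions as pointwise linear constraints\<close>

text \<open>\<open>alpha\<close> is antisymmetric and the nonlocal gradient symmetric, so the
  integrand doubles; on the collar only \<open>- u x\<close> remains of the increment. If the kernel
  is not integrable over the collar, both sides have the default value 0.\<close>

lemma nl_normal_grad:
  assumes [measurable]: "S \<in> sets borel" "u \<in> borel_measurable M"
    and off: "AE y in lborel. y \<in> \<Omega> - S \<longrightarrow> u y = 0"
  shows "nl_normal r \<Omega> S (nl_grad r u) x = (- 2 * (LINT y:(\<Omega> - S)|lborel. (norm (alpha r x y))\<^sup>2)) * u x"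
proof -
  have alpha_swap: "alpha r y x = - alpha r x y" for y
    by (simp add: alpha_def norm_minus_commute flip: scaleR_minus_right)
  have [measurable]: "(\<lambda>y. alpha r x y) \<in> borel_measurable borel"
    unfolding alpha_def by measurable
  have [measurable]: "(\<lambda>y. indicator \<Omega> y *\<^sub>R u y) \<in> borel_measurable borel"
    using borel_measurable_restrict_space_iff[of \<Omega> lborel u] by simp
  have "nl_normal r \<Omega> S (nl_grad r u) x
      = (LINT y|lborel. indicator (\<Omega> - S) y * (2 * (indicator \<Omega> y *\<^sub>R u y - u x) * (norm (alpha r x y))\<^sup>2))"
    unfolding nl_normal_def set_lebesgue_integral_def
    by (intro Bochner_Integration.integral_cong)
      (auto simp: nl_grad_def alpha_swap[of] power2_norm_eq_inner indicator_def algebra_simps)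
  also have "\<dots> = (LINT y|lborel. (- 2 * u x) * (indicator (\<Omega> - S) y * (norm (alpha r x y))\<^sup>2))"
  proof (rule integral_cong_AE)
    show "AE y in lborel. indicator (\<Omega> - S) y * (2 * (indicator \<Omega> y *\<^sub>R u y - u x) * (norm (alpha r x y))\<^sup>2)
      = (- 2 * u x) * (indicator (\<Omega> - S) y * (norm (alpha r x y))\<^sup>2)"
      using off by eventually_elim (auto simp: indicator_def)
  qed measurable
  also have "\<dots> = (- 2 * u x) * (LINT y:(\<Omega> - S)|lborel. (norm (alpha r x y))\<^sup>2)"
    unfolding set_lebesgue_integral_def by (subst integral_mult_right_zero) simp
  finally show ?thesis
    by simp
qed

text \<open>Indicator coefficients turn conditions on subsets into equations that hold a.e. on
  \<Omega>.\<close>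

lemma hinged_space_eq:
  assumes "S \<subseteq> \<Omega>"
  shows "hinged_space r \<Omega> S T = constrained_space (indicator (\<Omega> - S)) (indicator (S - T))"
proof -
  have "(AE x in lborel. x \<in> \<Omega> - S \<longrightarrow> u x = 0) \<and> (AE x in lborel. x \<in> S - T \<longrightarrow> v x = 0)
    \<longleftrightarrow> (AE x in M. indicator (\<Omega> - S) x * u x = 0 \<and> indicator (S - T) x * v x = 0)"
    for u v :: "'a \<Rightarrow> real"
    using assms unfolding AE_conj_iff[symmetric]
    by (subst AE_restrict_space_iff) (auto simp: indicator_def intro!: AE_cong)
  then show ?thesis
    by (auto simp: hinged_space_def constrained_space_def H1_0_def H2_def)
qed

text \<open>The two coefficients have disjoint supports, the collar and \<open>S\<close>, so one
  equation for \<open>u\<close> encodes both conditions. The product formula for the normal operator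
  presupposes the collar condition \<open>?P\<close>, so \<open>?Q\<close> is rewritten only under
  it.\<close>

lemma clamped_space_eq:
  assumes "open S" "S \<subseteq> \<Omega>"
  defines "k \<equiv> (\<lambda>x. indicator S x * (- 2 * (LINT y:(\<Omega> - S)|lborel. (norm (alpha r x y))\<^sup>2)))"
  shows "clamped_space r \<Omega> S = constrained_space (\<lambda>x. indicator (\<Omega> - S) x + k x) (\<lambda>x. 0)"
proof -
  have "(AE x in lborel. x \<in> \<Omega> - S \<longrightarrow> u x = 0) \<and>
      (AE x in lborel. x \<in> interior S \<longrightarrow> nl_normal r \<Omega> S (nl_grad r u) x = 0)
    \<longleftrightarrow> (AE x in M. (indicator (\<Omega> - S) x + k x) * u x = 0)" (is "?P \<and> ?Q \<longleftrightarrow> ?R")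
    if "u \<in> H1 r \<Omega>" for u
  proof -
    have R: "?R \<longleftrightarrow> ?P \<and> (AE x in lborel. x \<in> S \<longrightarrow> k x * u x = 0)"
      using assms(2) unfolding AE_conj_iff[symmetric]
      by (subst AE_restrict_space_iff) (auto simp: indicator_def k_def intro!: AE_cong)
    have "?Q \<longleftrightarrow> (AE x in lborel. x \<in> S \<longrightarrow> k x * u x = 0)" if ?P
    proof -
      have "u \<in> borel_measurable M"
        using \<open>u \<in> H1 r \<Omega>\<close> by (simp add: H1_iff square_integrable_def)
      from nl_normal_grad[OF _ this that] show ?thesis
        using assms(1) by (auto simp: interior_open k_def intro!: AE_cong)
    qed
    then show ?thesis
      using R by blast
  qed
  then show ?thesis
    by (auto simp: clamped_space_def constrained_space_def H1_0_def H2_def)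
qed

end

theorem proposition6p1:
  fixes \<Omega> \<Omega>' \<Omega>'' :: "'a::euclidean_space set"
    and \<delta> :: real and \<rho> :: "real \<Rightarrow> real"
    and f :: "'a \<Rightarrow> real" and H :: "('a \<Rightarrow> real) set"
  assumes "DIM('a) \<ge> 2"
    and "open \<Omega>" and "bounded \<Omega>"
    and "open \<Omega>'" and "open \<Omega>''"
    and "\<Omega>'' \<subset>\<subset> \<Omega>'" and "\<Omega>' \<subset>\<subset> \<Omega>"
    and "\<delta> > 0" and "nonlocal_kernel TYPE('a) \<delta> \<rho>"
    and "reaches_collar \<rho> \<Omega>' \<Omega>"
    and "f \<in> L2_on \<Omega>'"
    and "H = hinged_space \<rho> \<Omega> \<Omega>' \<Omega>'' \<or> H = clamped_space \<rho> \<Omega> \<Omega>'"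
  shows "\<exists>u. weak_biharmonic_solution \<rho> \<Omega> \<Omega>' H f u \<and>
             (\<forall>w. weak_biharmonic_solution \<rho> \<Omega> \<Omega>' H f w \<longrightarrow>
                  (AE x in lborel. x \<in> \<Omega> \<longrightarrow> w x = u x))"
proof -
  have subset: "\<Omega>' \<subseteq> \<Omega>"
    using assms(7) closure_subset unfolding compactly_contained_def by blast
  have [measurable]: "\<Omega> \<in> sets borel" "\<Omega>' \<in> sets borel"
    using assms by auto
  have "continuous_on {0..} \<rho>"
    using assms(9) unfolding nonlocal_kernel_def smooth_half_line_def continuous_on_eq_continuous_within
    by (metis DERIV_continuous atLeast_iff)
  then interpret nonlocal_domain \<rho> \<Omega>
    using assms(2,3,9) by unfold_locales (auto simp: nonlocal_kernel_def)
  \<comment> \<open>The value 1 on the collar makes the constraint force \<open>u = 0\<close> there,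
    which is the support condition in the Poincare inequality.\<close>
  obtain p q where H: "H = constrained_space p q" and p: "\<And>x. x \<in> \<Omega> - \<Omega>' \<Longrightarrow> p x = 1"
    using assms(12)
  proof
    assume "H = hinged_space \<rho> \<Omega> \<Omega>' \<Omega>''"
    then show thesis
      using that hinged_space_eq[OF subset] by simp
  next
    assume "H = clamped_space \<rho> \<Omega> \<Omega>'"
    then show thesis
      by (intro that[OF trans[OF _ clamped_space_eq[OF assms(4) subset]]]) auto
  qed
  obtain t where t: "0 < t" "0 < \<rho> t" "\<And>x. x \<in> \<Omega>' \<Longrightarrow> cball x t \<subseteq> \<Omega>"
    using assms(10) by (auto simp: reaches_collar_def)
  obtain C where C: "0 \<le> C" and Poincare: "\<And>u. u \<in> H1 \<rho> \<Omega> \<Longrightarrow> AE x in M. x \<notin> \<Omega>' \<longrightarrow> u x = 0 \<Longrightarrow>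
      (LINT x|M. (u x)\<^sup>2) \<le> C * (LINT p|MM. (D u p)\<^sup>2)"
    using Poincare[OF _ t] \<open>\<Omega>' \<in> sets borel\<close> by blast
  have Poincare_H: "(LINT x|M. (u x)\<^sup>2) \<le> C * (LINT p|MM. (D u p)\<^sup>2)"
    if "u \<in> constrained_space p q" for u
  proof (rule Poincare)
    show "AE x in M. x \<notin> \<Omega>' \<longrightarrow> u x = 0"
      using constrained_spaceD(2)[OF that] AE_space
      by eventually_elim (use p in \<open>auto simp: space_restrict_space\<close>)
  qed (rule laplacian_H1[OF constrained_spaceD(1)[OF that]])
  \<comment> \<open>Extending the load by zero turns it into a square integrable function on all of
    \<Omega> with the same pairing.\<close>
  define g where "g x = indicator \<Omega>' x * f x" for x
  have "indicator \<Omega> x *\<^sub>R g x = indicator \<Omega>' x *\<^sub>R f x"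
    "indicator \<Omega> x *\<^sub>R (g x)\<^sup>2 = indicator \<Omega>' x *\<^sub>R (norm (f x))\<^sup>2" for x
    using subset by (auto simp: g_def indicator_def)
  then have g: "square_integrable M g"
    using assms(11) by (simp add: square_integrable_def L2_on_def set_borel_measurable_def
        set_integrable_def borel_measurable_restrict_space_iff integrable_restrict_space)
  have load: "(LINT x:\<Omega>'|lborel. f x * v x) = (LINT x|M. g x * v x)" for v
    unfolding set_lebesgue_integral_def g_def using subset
    by (subst integral_restrict_space) (auto intro!: Bochner_Integration.integral_cong simp: indicator_def)
  have weak: "weak_biharmonic_solution \<rho> \<Omega> \<Omega>' H f u \<longleftrightarrow>
      u \<in> constrained_space p q \<and> (\<forall>v\<in>constrained_space p q. biform u v = (LINT x|M. g x * v x))" for u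
    by (simp add: weak_biharmonic_solution_def H load set_integral_domain biform_def)
  have AE_M: "(AE x in M. P x) \<longleftrightarrow> (AE x in lborel. x \<in> \<Omega> \<longrightarrow> P x)" for P
    by (simp add: AE_restrict_space_iff)
  show ?thesis
    using biharmonic_well_posed[of C p q, OF C Poincare_H g] unfolding weak AE_M by blast
qed

end
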